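(* Let $k\ge1$ be an integer, $0<\epsilon<1$, and let $I(t)$, $\mathcal{I}^\perp$, $D$, $U_t$, $F$, $\zeta_j$, $a_j$, $J$, $\omega_{m,n}$, $\beta_{r,n}(t)$ be as defined in the context; in particular, the equation $D\xi(t)=0$ for all $t\in\mathbb{R}$ has a unique solution for every initial value $\xi(0)\in I(0)^\perp$, and $U_t:I(0)^\perp\to I(t)^\perp$ is its solution operator, $U_t(\xi(0))=\xi(t)$. Then: (a) The solution operator $U_t:I(0)^\perp\to I(t)^\perp$ acts diagonally by $$U_t\big(\beta_{r,n}(0)\big)=e^{i f_{r,n}t}\beta_{r,n}(t),\qquad (r,n)\in J,\ t\in\mathbb{R},$$ where the frequencies $f_{r,n}$ are given by $$f_{r,n}=\frac{\sum_{q\in\mathbb{N}}\omega_{r+kq,n}^{-1}\,q\,\epsilon^{2q}}{\sum_{q\in\mathbb{N}}\omega_{r+kq,n}^{-1}\,\epsilon^{2q}}=\frac{-r\sum_{j=0}^{k-1}\zeta_j^{-r}a_j^{-n-1}+F(n+1)\sum_{j=0}^{k-1}\zeta_j^{-r+1}a_j^{-n-2}}{k\sum_{j=0}^{k-1}\zeta_j^{-r}a_j^{-n-1}}.$$ (b) The operator $U_t:I(0)^\perp\to I(t)^\perp$ is unitary for every $t\in\mathbb{R}$. (c) When $n\to\infty$, $f_{r,n}$ varies asymptotically like $$\frac{F}{k(1-F)}n+\frac{F}{k(1-F)}-\frac{r}{k}$$ (that is, the difference tends to $0$ for each fixed $r$). (d) A smooth orthonormal parallel frame for the Hilbert bundle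 $\mathcal{I}^\perp$ is given by $\gamma:=\{\gamma_{r,n}(t):=e^{i f_{r,n}t}\beta_{r,n}(t): (r,n)\in J,\ t\in\mathbb{R}\}$; that is, each $\gamma_{r,n}$ is a smooth section of $\mathcal{I}^\perp$ with $D\gamma_{r,n}=0$, and for each $t$ the family $\{\gamma_{r,n}(t)\}_{(r,n)\in J}$ is an orthonormal basis of $I(t)^\perp$.
   Context: $\mathbb{N}=\{0,1,2,\dots\}$. $H^2_2$ is the Drury-Arveson space on the unit ball $\mathbb{B}^2\subset\mathbb{C}^2$: the Hilbert space of analytic functions in which the monomials form an orthogonal basis and $\|z_1^mz_2^n\|^2=\omega_{m,n}:=\binom{m+n}{m}^{-1}$. For $t\in\mathbb{R}$, $I(t)=\langle z_1^k-\epsilon e^{it}\rangle\subseteq\mathbb{C}[z_1,z_2]$ is the principal ideal, $I(t)^\perp$ its orthogonal complement in $H^2_2$, $P_t$ the orthogonal projection of $H^2_2$ onto $I(t)^\perp$, and $\mathcal{I}^\perp=\{(t,\xi):\xi\in I(t)^\perp\}\subseteq\mathbb{R}\times H^2_2$, a smooth Hilbert bundle over $\mathbb{R}$. $C^\infty(\mathbb{R};\mathcal{I}^\perp)$ is the space of smooth sections, i.e. smooth functions $\xi:\mathbb{R}\to H^2_2$ with $\xi(t)\in I(t)^\perp$ for all $t$. Set $$F:=\epsilon^{2/k},\quad \zeta_j:=e^{2\pi i j/k},\quad a_j:=1-\zeta_jF\ (0\le j\le k-1),\quad J:=\{(r,n)\in\mathbb{N}^2:0\le r\le k-1\},$$ $$\alpha_{r,n}(t):=\sum_{q\in\mathbb{N}}\omega_{r+kq,n}^{-1}\epsilon^qe^{-iqt}z_1^{r+kq}z_2^n,\qquad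 \beta_{r,n}(t):=\frac{\alpha_{r,n}(t)}{\|\alpha_{r,n}(t)\|}.$$ The connection $D$ is $D\xi(t)=P_t\big(\frac{d\xi}{dt}(t)\big)$ for $\xi\in C^\infty(\mathbb{R};\mathcal{I}^\perp)$; a section $\xi\in C^\infty(\mathbb{R};\mathcal{I}^\perp)$ is $D$-flat (parallel) if $D\xi(t)=0$ for all $t\in\mathbb{R}$. The equation $D\xi=0$ is asserted to have a unique solution operator for all $t\in\mathbb{R}$ and any initial value $\xi(0)\in I(0)^\perp$; the resulting solution map $U_t:I(0)^\perp\to I(t)^\perp$, $t\in\mathbb{R}$, sends the initial value $\xi(0)$ of a flat section $\xi$ to its time-$t$ value $\xi(t)$.
   Formalization: Smooth solutions of Dξ=0 do not exist for every ξ(0) in I(0)^⊥ (the norms of γ'_{r,n} are unbounded), so U_t is defined by uniform limits of smooth flat sections; unique solvability in this sense is proved, and U_t(ξ(0))=ξ(t) for every smooth flat ξ. *)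

theory Defs
  imports "HOL-Analysis.Analysis" "HOL-Computational_Algebra.Polynomial"
begin

text \<open>The type \<^typ>\<open>complex \<times> complex\<close> carries the Euclidean norm, so \<^term>\<open>ball 0 1\<close> is the
  unit ball \<open>|z\<^sub>1|^2 + |z\<^sub>2|^2 < 1\<close>.\<close>

definition da_weight :: "nat \<Rightarrow> nat \<Rightarrow> real" where
  "da_weight m n = 1 / real ((m + n) choose m)"

text \<open>\<open>da_expansion c f\<close>: the function \<open>f\<close> on the ball has the power series \<open>c\<close>, and \<open>c\<close> has
  finite weighted square norm.  Since HOL functions are total, functions on the ball are
  represented by their extension by \<open>0\<close>.\<close>

definition da_expansion :: "(nat \<times> nat \<Rightarrow> complex) \<Rightarrow> (complex \<times> complex \<Rightarrow> complex) \<Rightarrow> bool" where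
  "da_expansion c f \<longleftrightarrow>
     (\<lambda>(m, n). da_weight m n * (cmod (c (m, n)))\<^sup>2) summable_on UNIV \<and>
     (\<forall>z\<in>ball 0 1. ((\<lambda>(m, n). c (m, n) * fst z ^ m * snd z ^ n) has_sum f z) UNIV) \<and>
     (\<forall>z. z \<notin> ball 0 1 \<longrightarrow> f z = 0)"

lemma da_weight_pos [simp]: "da_weight m n > 0"
  by (simp add: da_weight_def)

lemma da_weight_nonneg [simp]: "da_weight m n \<ge> 0"
  using da_weight_pos[of m n] by linarith

lemma da_expansion_0: "da_expansion (\<lambda>_. 0) (\<lambda>_. 0)"
  by (simp add: da_expansion_def case_prod_unfold)

lemma da_sq_add:
  assumes "(\<lambda>(m, n). da_weight m n * (cmod (c (m, n)))\<^sup>2) summable_on UNIV"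
    and "(\<lambda>(m, n). da_weight m n * (cmod (d (m, n)))\<^sup>2) summable_on UNIV"
  shows "(\<lambda>(m, n). da_weight m n * (cmod (c (m, n) + d (m, n)))\<^sup>2) summable_on UNIV"
proof (rule summable_on_comparison_test)
  show "(\<lambda>p. 2 * (case p of (m, n) \<Rightarrow> da_weight m n * (cmod (c (m, n)))\<^sup>2)
      + 2 * (case p of (m, n) \<Rightarrow> da_weight m n * (cmod (d (m, n)))\<^sup>2)) summable_on UNIV"
    by (intro summable_on_add summable_on_cmult_right assms)
next
  fix p :: "nat \<times> nat"
  obtain m n where p: "p = (m, n)" by fastforce
  have "(cmod (c p + d p))\<^sup>2 \<le> (cmod (c p) + cmod (d p))\<^sup>2"
    by (intro power_mono norm_triangle_ineq) auto
  also have "\<dots> \<le> 2 * (cmod (c p))\<^sup>2 + 2 * (cmod (d p))\<^sup>2"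
    using sum_squares_bound[of "cmod (c p)" "cmod (d p)"] by (simp add: power2_sum)
  finally have "da_weight m n * (cmod (c p + d p))\<^sup>2
      \<le> da_weight m n * (2 * (cmod (c p))\<^sup>2 + 2 * (cmod (d p))\<^sup>2)"
    by (intro mult_left_mono) auto
  then show "(case p of (m, n) \<Rightarrow> da_weight m n * (cmod (c (m, n) + d (m, n)))\<^sup>2)
      \<le> 2 * (case p of (m, n) \<Rightarrow> da_weight m n * (cmod (c (m, n)))\<^sup>2)
        + 2 * (case p of (m, n) \<Rightarrow> da_weight m n * (cmod (d (m, n)))\<^sup>2)"
    by (simp add: p algebra_simps)
qed auto

lemma da_expansion_add:
  assumes "da_expansion c f" "da_expansion d g"
  shows "da_expansion (\<lambda>p. c p + d p) (\<lambda>z. f z + g z)"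
proof -
  have "((\<lambda>(m, n). (c (m, n) + d (m, n)) * fst z ^ m * snd z ^ n) has_sum (f z + g z)) UNIV"
    if "z \<in> ball 0 1" for z
  proof -
    have "((\<lambda>p. (case p of (m, n) \<Rightarrow> c (m, n) * fst z ^ m * snd z ^ n)
        + (case p of (m, n) \<Rightarrow> d (m, n) * fst z ^ m * snd z ^ n)) has_sum (f z + g z)) UNIV"
      using assms that by (intro has_sum_add) (auto simp: da_expansion_def)
    then show ?thesis by (simp add: case_prod_unfold algebra_simps)
  qed
  then show ?thesis
    using assms da_sq_add[of c d] unfolding da_expansion_def by simp
qed

lemma da_expansion_scale:
  assumes "da_expansion c f"
  shows "da_expansion (\<lambda>p. a * c p) (\<lambda>z. a * f z)"
proof -
  have "((\<lambda>(m, n). (a * c (m, n)) * fst z ^ m * snd z ^ n) has_sum (a * f z)) UNIV"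
    if "z \<in> ball 0 1" for z
  proof -
    have "((\<lambda>p. a * (case p of (m, n) \<Rightarrow> c (m, n) * fst z ^ m * snd z ^ n)) has_sum (a * f z)) UNIV"
      using assms that by (intro has_sum_cmult_right) (auto simp: da_expansion_def)
    then show ?thesis by (simp add: case_prod_unfold algebra_simps)
  qed
  moreover have "(\<lambda>(m, n). da_weight m n * (cmod (a * c (m, n)))\<^sup>2) summable_on UNIV"
  proof -
    have "(\<lambda>p. (cmod a)\<^sup>2 * (case p of (m, n) \<Rightarrow> da_weight m n * (cmod (c (m, n)))\<^sup>2)) summable_on UNIV"
      using assms by (intro summable_on_cmult_right) (auto simp: da_expansion_def)
    then show ?thesis by (simp add: case_prod_unfold norm_mult power_mult_distrib algebra_simps)
  qed
  ultimately show ?thesis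
    using assms by (auto simp: da_expansion_def)
qed

lemma power_series_zero:
  fixes a :: "nat \<Rightarrow> complex"
  assumes "r > 0" and "\<And>x. norm x < r \<Longrightarrow> (\<lambda>n. a n * x ^ n) sums 0"
  shows "a n = 0"
proof -
  have "ereal r \<le> conv_radius a"
  proof (rule conv_radius_geI_ex)
    fix s assume s: "0 < s" "ereal s < ereal r"
    then have "summable (\<lambda>n. a n * of_real s ^ n)"
      using assms(2)[of "of_real s"] by (auto simp: sums_iff)
    then show "\<exists>z. norm z = s \<and> summable (\<lambda>n. a n * z ^ n)"
      using s by (intro exI[of _ "of_real s"]) auto
  qed
  then have rad: "fps_conv_radius (Abs_fps a) > 0"
    using assms(1) by (auto simp: fps_conv_radius_def intro: less_le_trans[of _ "ereal r"])
  have "Abs_fps a = 0"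
  proof (rule eval_fps_eqD)
    show "eventually (\<lambda>z. eval_fps (Abs_fps a) z = eval_fps 0 z) (nhds 0)"
      unfolding eventually_nhds_metric
      using assms by (intro exI[of _ r]) (auto simp: eval_fps_def sums_iff)
  qed (use rad in auto)
  then show ?thesis
    by (metis fps_nth_Abs_fps fps_zero_nth)
qed

lemma da_expansion_unique:
  assumes "da_expansion c f" "da_expansion d f"
  shows "c = d"
proof -
  define e where "e = (\<lambda>p. c p + (-1) * d p)"
  have "da_expansion e (\<lambda>z. f z + (-1) * f z)"
    unfolding e_def by (intro da_expansion_add da_expansion_scale assms)
  then have e: "((\<lambda>(m, n). e (m, n) * fst z ^ m * snd z ^ n) has_sum 0) UNIV"
    if "z \<in> ball 0 1" for z
    using that by (auto simp: da_expansion_def)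
  have inball: "(x, y) \<in> ball 0 1" if "norm x < 1/2" "norm y < 1/2" for x y :: complex
  proof -
    have "norm (x, y) \<le> norm x + norm y" by (rule norm_Pair_le)
    with that show ?thesis by (simp add: mem_ball_0)
  qed
  have "e (m, n) = 0" for m n
  proof -
    have y: "(\<lambda>n. e (m, n) * y ^ n) sums 0" if yr: "norm y < 1/2" for m y
    proof -
      have slice: "(\<lambda>n. e (m, n) * x ^ m * y ^ n) summable_on UNIV"
        if "norm x < 1/2" for m x
        using summable_on_SigmaD1[of "\<lambda>m n. e (m, n) * x ^ m * y ^ n" UNIV "\<lambda>_. UNIV" m]
          e[OF inball[OF that yr]] by (auto simp: has_sum_iff)
      have slice': "(\<lambda>n. e (m, n) * y ^ n) summable_on UNIV" for m
      proof -
        have "(\<lambda>n. (1/3) ^ m * (e (m, n) * y ^ n)) summable_on UNIV"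
          using slice[of "1/3" m] by (simp add: algebra_simps)
        then show ?thesis by (subst (asm) summable_on_cmult_right') auto
      qed
      define h where "h = (\<lambda>m. \<Sum>\<^sub>\<infinity>n. e (m, n) * y ^ n)"
      have "(\<lambda>m. h m * x ^ m) sums 0" if xr: "norm x < 1/2" for x
      proof (rule has_sum_imp_sums, rule has_sum_SigmaD)
        show "((\<lambda>(m, n). e (m, n) * x ^ m * y ^ n) has_sum 0) (UNIV \<times> UNIV)"
          using e[OF inball[OF xr yr]] by simp
        fix m
        have "((\<lambda>n. e (m, n) * y ^ n * x ^ m) has_sum (h m * x ^ m)) UNIV"
          unfolding h_def by (intro has_sum_cmult_left has_sum_infsum slice')
        then show "((\<lambda>n. (\<lambda>(m, n). e (m, n) * x ^ m * y ^ n) (m, n)) has_sum (h m * x ^ m)) UNIV"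
          by (simp add: algebra_simps)
      qed
      then have "h m = 0"
        by (intro power_series_zero[of "1/2" h m]) auto
      then show ?thesis
        using has_sum_infsum[OF slice'[of m]] by (auto simp: h_def intro: has_sum_imp_sums)
    qed
    then show ?thesis
      by (intro power_series_zero[of "1/2" "\<lambda>n. e (m, n)" n]) auto
  qed
  then show ?thesis by (auto simp: e_def fun_eq_iff)
qed

typedef drury_arveson = "{f :: complex \<times> complex \<Rightarrow> complex. \<exists>c. da_expansion c f}"
  morphisms da_fun Abs_da
  using da_expansion_0 by blast

setup_lifting type_definition_drury_arveson

definition da_coeff :: "drury_arveson \<Rightarrow> nat \<times> nat \<Rightarrow> complex" where
  "da_coeff f = (THE c. da_expansion c (da_fun f))"

lemma da_expansion_coeff: "da_expansion (da_coeff f) (da_fun f)"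
proof -
  obtain c where c: "da_expansion c (da_fun f)"
    using da_fun[of f] by blast
  show ?thesis
    unfolding da_coeff_def
    by (rule theI[where P = "\<lambda>c. da_expansion c (da_fun f)", OF c], rule da_expansion_unique[OF _ c])
qed

lemma da_coeff_eqI: "da_expansion c (da_fun f) \<Longrightarrow> da_coeff f = c"
  using da_expansion_coeff da_expansion_unique by blast

lemma da_coeff_sq_summable:
  "(\<lambda>(m, n). da_weight m n * (cmod (da_coeff f (m, n)))\<^sup>2) summable_on UNIV"
  using da_expansion_coeff[of f] by (simp add: da_expansion_def)

lift_definition da_scale :: "complex \<Rightarrow> drury_arveson \<Rightarrow> drury_arveson" (infixr "*\<^sub>C" 75)
  is "\<lambda>a f z. a * f z"
  using da_expansion_scale by blast

text \<open>Linear in the first argument; \<^const>\<open>inner\<close> and \<^const>\<open>norm\<close> on the type are derived from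
  it below, with its real part as the real inner product.\<close>

definition da_cinner :: "drury_arveson \<Rightarrow> drury_arveson \<Rightarrow> complex" where
  "da_cinner f g = (\<Sum>\<^sub>\<infinity>(m, n). da_weight m n * da_coeff f (m, n) * cnj (da_coeff g (m, n)))"

instantiation drury_arveson :: real_vector
begin

lift_definition zero_drury_arveson :: drury_arveson is "\<lambda>_. 0"
  using da_expansion_0 by blast

lift_definition plus_drury_arveson :: "drury_arveson \<Rightarrow> drury_arveson \<Rightarrow> drury_arveson"
  is "\<lambda>f g z. f z + g z"
  using da_expansion_add by blast

definition uminus_drury_arveson :: "drury_arveson \<Rightarrow> drury_arveson" where
  "uminus_drury_arveson f = (-1) *\<^sub>C f"

definition minus_drury_arveson :: "drury_arveson \<Rightarrow> drury_arveson \<Rightarrow> drury_arveson" where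
  "minus_drury_arveson f g = f + (- g)"

definition scaleR_drury_arveson :: "real \<Rightarrow> drury_arveson \<Rightarrow> drury_arveson" where
  "scaleR_drury_arveson r f = complex_of_real r *\<^sub>C f"

instance
proof
  fix f g h :: drury_arveson and a b :: real
  show "f + g + h = f + (g + h)" "f + g = g + f" "0 + f = f"
    by (transfer; simp add: algebra_simps)+
  show "- f + f = 0" "f - g = f + - g"
    unfolding uminus_drury_arveson_def minus_drury_arveson_def by (transfer; simp)+
  show "a *\<^sub>R (f + g) = a *\<^sub>R f + a *\<^sub>R g" "(a + b) *\<^sub>R f = a *\<^sub>R f + b *\<^sub>R f"
    "a *\<^sub>R b *\<^sub>R f = (a * b) *\<^sub>R f" "1 *\<^sub>R f = f"
    unfolding scaleR_drury_arveson_def by (transfer; simp add: algebra_simps)+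
qed

end

lemma da_coeff_add: "da_coeff (f + g) = (\<lambda>p. da_coeff f p + da_coeff g p)"
  by (rule da_coeff_eqI, unfold plus_drury_arveson.rep_eq)
    (rule da_expansion_add[OF da_expansion_coeff da_expansion_coeff])

lemma da_coeff_scale: "da_coeff (a *\<^sub>C f) = (\<lambda>p. a * da_coeff f p)"
  by (rule da_coeff_eqI, unfold da_scale.rep_eq) (rule da_expansion_scale[OF da_expansion_coeff])

lemma da_coeff_0: "da_coeff 0 = (\<lambda>_. 0)"
  by (rule da_coeff_eqI, unfold zero_drury_arveson.rep_eq) (rule da_expansion_0)

lemma da_coeff_scaleR: "da_coeff (r *\<^sub>R f) = (\<lambda>p. of_real r * da_coeff f p)"
  by (simp add: scaleR_drury_arveson_def da_coeff_scale)

lemma da_coeff_diff: "da_coeff (f - g) = (\<lambda>p. da_coeff f p - da_coeff g p)"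
  by (simp add: minus_drury_arveson_def uminus_drury_arveson_def da_coeff_add da_coeff_scale)

lemma da_eqI:
  assumes "da_coeff f = da_coeff g"
  shows "f = g"
proof -
  have "da_fun f z = da_fun g z" for z
  proof (cases "z \<in> ball 0 1")
    case True
    have "((\<lambda>(m, n). da_coeff g (m, n) * fst z ^ m * snd z ^ n) has_sum da_fun f z) UNIV"
      using da_expansion_coeff[of f] True unfolding da_expansion_def assms by blast
    moreover have "((\<lambda>(m, n). da_coeff g (m, n) * fst z ^ m * snd z ^ n) has_sum da_fun g z) UNIV"
      using da_expansion_coeff[of g] True unfolding da_expansion_def by blast
    ultimately show ?thesis by (rule has_sum_unique)
  next
    case False
    with da_expansion_coeff[of f] da_expansion_coeff[of g] show ?thesis
      unfolding da_expansion_def by metis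
  qed
  then show ?thesis by (simp add: da_fun_inject[symmetric] ext)
qed

lemma da_cinner_summable:
  "(\<lambda>(m, n). da_weight m n * da_coeff f (m, n) * cnj (da_coeff g (m, n))) summable_on UNIV"
proof (rule abs_summable_summable, rule summable_on_comparison_test)
  show "(\<lambda>p. (case p of (m, n) \<Rightarrow> da_weight m n * (cmod (da_coeff f (m, n)))\<^sup>2)
      + (case p of (m, n) \<Rightarrow> da_weight m n * (cmod (da_coeff g (m, n)))\<^sup>2)) summable_on UNIV"
    by (intro summable_on_add da_coeff_sq_summable)
next
  fix p :: "nat \<times> nat"
  obtain m n where p: "p = (m, n)" by fastforce
  have "2 * (cmod (da_coeff f p) * cmod (da_coeff g p))
      \<le> (cmod (da_coeff f p))\<^sup>2 + (cmod (da_coeff g p))\<^sup>2"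
    using sum_squares_bound[of "cmod (da_coeff f p)" "cmod (da_coeff g p)"] by simp
  moreover have "0 \<le> cmod (da_coeff f p) * cmod (da_coeff g p)" by simp
  ultimately have "cmod (da_coeff f p) * cmod (da_coeff g p)
      \<le> (cmod (da_coeff f p))\<^sup>2 + (cmod (da_coeff g p))\<^sup>2" by linarith
  from mult_left_mono[OF this da_weight_nonneg[of m n]]
  show "norm (case p of (m, n) \<Rightarrow> da_weight m n * da_coeff f (m, n) * cnj (da_coeff g (m, n)))
      \<le> (case p of (m, n) \<Rightarrow> da_weight m n * (cmod (da_coeff f (m, n)))\<^sup>2)
      + (case p of (m, n) \<Rightarrow> da_weight m n * (cmod (da_coeff g (m, n)))\<^sup>2)"
    by (simp add: p norm_mult algebra_simps)
qed auto

lemma da_cinner_add_left: "da_cinner (f + g) h = da_cinner f h + da_cinner g h"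
  unfolding da_cinner_def
  by (subst infsum_add[symmetric, OF da_cinner_summable da_cinner_summable])
    (simp add: da_coeff_add case_prod_unfold algebra_simps)

lemma da_cinner_scale_left: "da_cinner (a *\<^sub>C f) h = a * da_cinner f h"
  unfolding da_cinner_def
  by (subst infsum_cmult_right'[symmetric])
    (simp add: da_coeff_scale case_prod_unfold algebra_simps)

lemma da_cinner_commute: "da_cinner g f = cnj (da_cinner f g)"
  unfolding da_cinner_def infsum_cnj[symmetric]
  by (simp add: case_prod_unfold algebra_simps)

lemma da_cinner_self:
  "da_cinner f f = of_real (\<Sum>\<^sub>\<infinity>(m, n). da_weight m n * (cmod (da_coeff f (m, n)))\<^sup>2)"
proof -
  have "((\<lambda>p. complex_of_real (case p of (m, n) \<Rightarrow> da_weight m n * (cmod (da_coeff f (m, n)))\<^sup>2))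
    has_sum of_real (\<Sum>\<^sub>\<infinity>(m, n). da_weight m n * (cmod (da_coeff f (m, n)))\<^sup>2)) UNIV"
    by (intro has_sum_of_real has_sum_infsum da_coeff_sq_summable)
  then show ?thesis unfolding da_cinner_def
    by (intro infsumI) (simp add: case_prod_unfold mult.assoc flip: complex_norm_square)
qed

instantiation drury_arveson :: real_inner
begin

definition inner_drury_arveson :: "drury_arveson \<Rightarrow> drury_arveson \<Rightarrow> real" where
  "inner_drury_arveson f g = Re (da_cinner f g)"

definition norm_drury_arveson :: "drury_arveson \<Rightarrow> real" where
  "norm_drury_arveson f = sqrt (inner f f)"

definition sgn_drury_arveson :: "drury_arveson \<Rightarrow> drury_arveson" where
  "sgn_drury_arveson f = f /\<^sub>R norm f"

definition dist_drury_arveson :: "drury_arveson \<Rightarrow> drury_arveson \<Rightarrow> real" where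
  "dist_drury_arveson f g = norm (f - g)"

definition uniformity_drury_arveson :: "(drury_arveson \<times> drury_arveson) filter" where
  "uniformity_drury_arveson = (INF e\<in>{0<..}. principal {(x, y). dist x y < e})"

definition open_drury_arveson :: "drury_arveson set \<Rightarrow> bool" where
  "open_drury_arveson U \<longleftrightarrow> (\<forall>x\<in>U. \<forall>\<^sub>F (x', y) in uniformity. x' = x \<longrightarrow> y \<in> U)"

instance
proof
  fix x y z :: drury_arveson and r :: real
  show "inner x y = inner y x"
    unfolding inner_drury_arveson_def by (subst da_cinner_commute) simp
  show "inner (x + y) z = inner x z + inner y z"
    by (simp add: inner_drury_arveson_def da_cinner_add_left)
  show "inner (r *\<^sub>R x) y = r * inner x y"
    by (simp add: inner_drury_arveson_def scaleR_drury_arveson_def da_cinner_scale_left)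
  show ge: "inner x x \<ge> 0"
    by (auto simp: inner_drury_arveson_def da_cinner_self intro!: infsum_nonneg)
  show "inner x x = 0 \<longleftrightarrow> x = 0"
  proof
    assume "inner x x = 0"
    then have *: "(\<Sum>\<^sub>\<infinity>(m, n). da_weight m n * (cmod (da_coeff x (m, n)))\<^sup>2) \<le> 0"
      by (simp add: inner_drury_arveson_def da_cinner_self)
    have "da_coeff x p = 0" for p
      using nonneg_infsum_le_0D[OF * da_coeff_sq_summable, of p] da_weight_pos
      by (cases p) (auto simp: less_le)
    then show "x = 0" by (intro da_eqI) (auto simp: da_coeff_0)
  next
    assume "x = 0"
    then show "inner x x = 0"
      by (simp add: inner_drury_arveson_def da_cinner_self da_coeff_0 case_prod_unfold)
  qed
  show "norm x = sqrt (inner x x)" by (rule norm_drury_arveson_def)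
  show "sgn x = x /\<^sub>R norm x" by (rule sgn_drury_arveson_def)
  show "dist x y = norm (x - y)" by (rule dist_drury_arveson_def)
  show "uniformity = (INF e\<in>{0<..}. principal {(x, y :: drury_arveson). dist x y < e})"
    by (rule uniformity_drury_arveson_def)
  fix U :: "drury_arveson set"
  show "open U \<longleftrightarrow> (\<forall>x\<in>U. \<forall>\<^sub>F (x', y) in uniformity. x' = x \<longrightarrow> y \<in> U)"
    by (rule open_drury_arveson_def)
qed

end

lemma da_norm_sq:
  "(norm f)\<^sup>2 = (\<Sum>\<^sub>\<infinity>(m, n). da_weight m n * (cmod (da_coeff f (m, n)))\<^sup>2)"
  unfolding power2_norm_eq_inner[of f]
  by (simp only: inner_drury_arveson_def da_cinner_self Re_complex_of_real)

global_interpretation DA: vector_space da_scale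
  by standard (transfer; simp add: fun_eq_iff algebra_simps)+

lemma da_kernel_summable:
  fixes x y :: real
  assumes "x \<ge> 0" "y \<ge> 0" "x + y < 1"
  shows "(\<lambda>(m, n). inverse (da_weight m n) * x ^ m * y ^ n) summable_on UNIV"
proof (rule nonneg_bdd_above_summable_on)
  let ?g = "\<lambda>(m, n). inverse (da_weight m n) * x ^ m * y ^ n"
  show nonneg: "?g p \<ge> 0" for p
    using assms by (cases p) (simp add: da_weight_def)
  show "bdd_above (sum ?g ` {F. F \<subseteq> UNIV \<and> finite F})"
  proof (rule bdd_aboveI2)
    fix F :: "(nat \<times> nat) set"
    assume "F \<in> {F. F \<subseteq> UNIV \<and> finite F}"
    then have F: "finite F" by simp
    define K where "K = Max (insert 0 ((\<lambda>(m, n). m + n) ` F))"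
    have sub: "F \<subseteq> {(m, n). m + n \<le> K}"
      unfolding K_def using F by (auto intro!: Max_ge)
    have "finite {(m, n). m + n \<le> K}"
      by (rule finite_subset[of _ "{..K} \<times> {..K}"]) auto
    then have "sum ?g F \<le> sum ?g {(m, n). m + n \<le> K}"
      using sub nonneg by (intro sum_mono2) auto
    also have "\<dots> = (\<Sum>N\<le>K. \<Sum>m\<le>N. inverse (da_weight m (N - m)) * x ^ m * y ^ (N - m))"
      by (rule sum.triangle_reindex_eq)
    also have "\<dots> = (\<Sum>N\<le>K. (x + y) ^ N)"
      by (intro sum.cong refl) (simp add: binomial_ring da_weight_def)
    also have "\<dots> \<le> (\<Sum>N. (x + y) ^ N)"
      using assms by (intro sum_le_suminf summable_geometric) auto
    finally show "sum ?g F \<le> (\<Sum>N. (x + y) ^ N)" .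
  qed
qed

lemma da_series_summable:
  assumes c: "(\<lambda>(m, n). da_weight m n * (cmod (c (m, n)))\<^sup>2) summable_on UNIV"
    and z: "z \<in> ball 0 1"
  shows "(\<lambda>(m, n). c (m, n) * fst z ^ m * snd z ^ n) summable_on UNIV"
proof (rule abs_summable_summable, rule summable_on_comparison_test)
  define x y where "x = (cmod (fst z))\<^sup>2" and "y = (cmod (snd z))\<^sup>2"
  have "sqrt (x + y) < 1"
    using z by (cases z) (simp add: x_def y_def norm_Pair mem_ball_0)
  then have xy: "x + y < 1" by simp
  show "(\<lambda>p. (case p of (m, n) \<Rightarrow> da_weight m n * (cmod (c (m, n)))\<^sup>2)
      + (case p of (m, n) \<Rightarrow> inverse (da_weight m n) * x ^ m * y ^ n)) summable_on UNIV"
    using xy by (intro summable_on_add c da_kernel_summable) (auto simp: x_def y_def)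
next
  fix p :: "nat \<times> nat"
  obtain m n where p: "p = (m, n)" by fastforce
  define w where "w = da_weight m n"
  define u where "u = sqrt w * cmod (c p)"
  define v where "v = inverse (sqrt w) * (cmod (fst z) ^ m * cmod (snd z) ^ n)"
  have w: "w > 0" by (simp add: w_def)
  have uv: "u * v = cmod (c p) * cmod (fst z) ^ m * cmod (snd z) ^ n"
    using w by (simp add: u_def v_def)
  have u2: "u\<^sup>2 = w * (cmod (c p))\<^sup>2"
    using w by (simp add: u_def power_mult_distrib)
  have v2: "v\<^sup>2 = inverse w * ((cmod (fst z))\<^sup>2) ^ m * ((cmod (snd z))\<^sup>2) ^ n"
    using w by (simp add: v_def power_mult_distrib power_inverse flip: power_mult)
      (simp add: mult.commute power_mult)
  have "u * v \<ge> 0"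
    using w by (simp add: u_def v_def)
  then have "u * v \<le> u\<^sup>2 + v\<^sup>2"
    using sum_squares_bound[of u v] by linarith
  then show "norm (case p of (m, n) \<Rightarrow> c (m, n) * fst z ^ m * snd z ^ n)
      \<le> (case p of (m, n) \<Rightarrow> da_weight m n * (cmod (c (m, n)))\<^sup>2)
      + (case p of (m, n) \<Rightarrow> inverse (da_weight m n) * ((cmod (fst z))\<^sup>2) ^ m * ((cmod (snd z))\<^sup>2) ^ n)"
    unfolding uv u2 v2 by (simp add: p norm_mult norm_power w_def)
qed auto

lemma da_coeff_surj:
  assumes "(\<lambda>(m, n). da_weight m n * (cmod (c (m, n)))\<^sup>2) summable_on UNIV"
  obtains f where "da_coeff f = c"
proof -
  define g where "g = (\<lambda>z. if z \<in> ball 0 1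
    then \<Sum>\<^sub>\<infinity>(m, n). c (m, n) * fst z ^ m * snd z ^ n else 0)"
  have "da_expansion c g"
    using assms da_series_summable[OF assms] by (simp add: da_expansion_def g_def)
  moreover from this have "da_fun (Abs_da g) = g"
    by (intro Abs_da_inverse) blast
  ultimately show ?thesis
    by (intro that[of "Abs_da g"] da_coeff_eqI) simp
qed

instance drury_arveson :: complete_space
proof
  fix X :: "nat \<Rightarrow> drury_arveson"
  assume X: "Cauchy X"
  define a where "a = (\<lambda>i. da_coeff (X i))"
  have part: "(\<Sum>(m, n)\<in>F. da_weight m n * (cmod (a i (m, n) - a j (m, n)))\<^sup>2) \<le> (dist (X i) (X j))\<^sup>2"
    if "finite F" for F i j
    unfolding dist_norm da_norm_sq
    using finite_sum_le_infsum[OF da_coeff_sq_summable[of "X i - X j"] that]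
    by (auto simp: da_coeff_diff a_def)
  have "Cauchy (\<lambda>i. a i p)" for p
  proof -
    obtain m n where p: "p = (m, n)" by fastforce
    define s where "s = sqrt (da_weight m n)"
    have s: "s > 0" by (simp add: s_def)
    have le: "s * dist (a i p) (a j p) \<le> dist (X i) (X j)" for i j
    proof (rule power2_le_imp_le)
      show "(s * dist (a i p) (a j p))\<^sup>2 \<le> (dist (X i) (X j))\<^sup>2"
        using part[of "{p}" i j] by (simp add: p s_def power_mult_distrib dist_norm)
    qed simp
    show ?thesis
    proof (rule metric_CauchyI)
      fix e :: real assume "e > 0"
      then obtain M where M: "\<And>i j. i \<ge> M \<Longrightarrow> j \<ge> M \<Longrightarrow> dist (X i) (X j) < s * e"
        using metric_CauchyD[OF X, of "s * e"] s by auto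
      have "dist (a i p) (a j p) < e" if "i \<ge> M" "j \<ge> M" for i j
      proof -
        have "s * dist (a i p) (a j p) < s * e"
          using le[of i j] M[OF that] by linarith
        with s show ?thesis by simp
      qed
      then show "\<exists>M. \<forall>i\<ge>M. \<forall>j\<ge>M. dist (a i p) (a j p) < e" by blast
    qed
  qed
  then have "\<forall>p. \<exists>l. (\<lambda>i. a i p) \<longlonglongrightarrow> l"
    by (meson Cauchy_convergent convergent_def)
  then obtain c where c: "\<And>p. (\<lambda>i. a i p) \<longlonglongrightarrow> c p" by metis
  have bound: "(\<Sum>(m, n)\<in>F. da_weight m n * (cmod (a i (m, n) - c (m, n)))\<^sup>2) \<le> e\<^sup>2"
    if F: "finite F" and M: "\<And>i j. i \<ge> M \<Longrightarrow> j \<ge> M \<Longrightarrow> dist (X i) (X j) < e" and i: "i \<ge> M"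
    for F M e i
  proof (rule tendsto_upperbound)
    show "(\<lambda>j. \<Sum>(m, n)\<in>F. da_weight m n * (cmod (a i (m, n) - a j (m, n)))\<^sup>2)
      \<longlonglongrightarrow> (\<Sum>(m, n)\<in>F. da_weight m n * (cmod (a i (m, n) - c (m, n)))\<^sup>2)"
      unfolding case_prod_unfold by (intro tendsto_intros c)
    show "\<forall>\<^sub>F j in sequentially.
      (\<Sum>(m, n)\<in>F. da_weight m n * (cmod (a i (m, n) - a j (m, n)))\<^sup>2) \<le> e\<^sup>2"
    proof (rule eventually_sequentiallyI[of M])
      fix j assume "j \<ge> M"
      then have "(dist (X i) (X j))\<^sup>2 \<le> e\<^sup>2"
        using M[OF i] by (intro power_mono) (auto simp: less_imp_le)
      with part[OF F, of i j]
      show "(\<Sum>(m, n)\<in>F. da_weight m n * (cmod (a i (m, n) - a j (m, n)))\<^sup>2) \<le> e\<^sup>2" by linarith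
    qed
  qed simp
  have diff: "(\<lambda>(m, n). da_weight m n * (cmod (a i (m, n) - c (m, n)))\<^sup>2) summable_on UNIV"
    if M: "\<And>i j. i \<ge> M \<Longrightarrow> j \<ge> M \<Longrightarrow> dist (X i) (X j) < e" and i: "i \<ge> M" for M e i
    by (rule nonneg_bdd_above_summable_on) (auto intro!: bdd_aboveI2 bound[OF _ M i])
  obtain M1 where M1: "\<And>i j. i \<ge> M1 \<Longrightarrow> j \<ge> M1 \<Longrightarrow> dist (X i) (X j) < 1"
    using metric_CauchyD[OF X, of 1] by auto
  obtain g where g: "da_coeff g = (\<lambda>p. a M1 p - c p)"
    using da_coeff_surj[OF diff[OF M1 order_refl]] by blast
  define Y where "Y = X M1 - g"
  have Y: "da_coeff Y = c"
    by (simp add: Y_def da_coeff_diff g a_def)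
  have "X \<longlonglongrightarrow> Y"
  proof (rule metric_LIMSEQ_I)
    fix r :: real assume r: "r > 0"
    obtain M where M: "\<And>i j. i \<ge> M \<Longrightarrow> j \<ge> M \<Longrightarrow> dist (X i) (X j) < r / 2"
      using metric_CauchyD[OF X, of "r / 2"] r by auto
    have "dist (X i) Y < r" if i: "i \<ge> M" for i
    proof -
      have "(dist (X i) Y)\<^sup>2 = (\<Sum>\<^sub>\<infinity>(m, n). da_weight m n * (cmod (a i (m, n) - c (m, n)))\<^sup>2)"
        by (simp add: dist_norm da_norm_sq da_coeff_diff Y a_def)
      also have "\<dots> \<le> (r / 2)\<^sup>2"
        by (rule infsum_le_finite_sums[OF diff[OF M i] bound[OF _ M i]])
      finally have "dist (X i) Y \<le> r / 2"
        by (rule power2_le_imp_le) (use r in auto)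
      with r show ?thesis by simp
    qed
    then show "\<exists>M. \<forall>i\<ge>M. dist (X i) Y < r" by blast
  qed
  then show "convergent X" by (auto simp: convergent_def)
qed

text \<open>\<open>\<complex>[z\<^sub>1, z\<^sub>2]\<close> is the type \<^typ>\<open>complex poly poly\<close>: the inner variable is \<open>z\<^sub>1\<close>, the outer
  one \<open>z\<^sub>2\<close>.\<close>

definition poly2 :: "complex poly poly \<Rightarrow> complex \<times> complex \<Rightarrow> complex" where
  "poly2 p z = poly (poly p [:snd z:]) (fst z)"

lemma poly_sum_atMost:
  fixes p :: "'a::comm_semiring_1 poly"
  assumes "degree p \<le> N"
  shows "poly p x = (\<Sum>i\<le>N. coeff p i * x ^ i)"
  unfolding poly_altdef using assms
  by (intro sum.mono_neutral_left) (auto simp: coeff_eq_0)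

lemma poly2_sum:
  assumes "degree p \<le> N" and "\<And>n. degree (coeff p n) \<le> M"
  shows "poly2 p z = (\<Sum>(m, n)\<in>{..M} \<times> {..N}. coeff (coeff p n) m * fst z ^ m * snd z ^ n)"
proof -
  have "poly2 p z = (\<Sum>n\<le>N. poly (coeff p n) (fst z) * snd z ^ n)"
    unfolding poly2_def using assms(1)
    by (subst poly_sum_atMost[of _ N]) (auto simp: poly_sum poly_power)
  also have "\<dots> = (\<Sum>n\<le>N. \<Sum>m\<le>M. coeff (coeff p n) m * fst z ^ m * snd z ^ n)"
    using assms(2) by (simp add: poly_sum_atMost[of _ M] sum_distrib_right)
  also have "\<dots> = (\<Sum>m\<le>M. \<Sum>n\<le>N. coeff (coeff p n) m * fst z ^ m * snd z ^ n)"
    by (rule sum.swap)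
  finally show ?thesis by (simp add: sum.cartesian_product)
qed

lemma da_expansion_poly2:
  "da_expansion (\<lambda>(m, n). coeff (coeff p n) m) (\<lambda>z. if z \<in> ball 0 1 then poly2 p z else 0)"
proof -
  define N where "N = degree p"
  define M where "M = Max ((\<lambda>n. degree (coeff p n)) ` {..N})"
  have M: "degree (coeff p n) \<le> M" for n
    by (cases "n \<le> N") (auto simp: M_def N_def coeff_eq_0)
  define S where "S = {..M} \<times> {..N}"
  have S: "finite S" by (simp add: S_def)
  have zero: "coeff (coeff p n) m = 0" if "(m, n) \<notin> S" for m n
    using that M[of n] by (auto simp: S_def N_def coeff_eq_0)
  have "((\<lambda>(m, n). coeff (coeff p n) m * fst z ^ m * snd z ^ n) has_sum poly2 p z) UNIV" for z
  proof -
    have "((\<lambda>(m, n). coeff (coeff p n) m * fst z ^ m * snd z ^ n) has_sum poly2 p z) S"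
      using poly2_sum[of p N M z] M S by (intro has_sum_finiteI) (auto simp: N_def S_def)
    then show ?thesis
      by (rule has_sum_cong_neutral[THEN iffD1, rotated -1]) (auto dest: zero)
  qed
  moreover have "(\<lambda>(m, n). da_weight m n * (cmod (coeff (coeff p n) m))\<^sup>2) summable_on UNIV"
  proof -
    have "(\<lambda>(m, n). da_weight m n * (cmod (coeff (coeff p n) m))\<^sup>2) summable_on S"
      using S by simp
    then show ?thesis
      by (rule summable_on_cong_neutral[THEN iffD1, rotated -1]) (auto dest: zero)
  qed
  ultimately show ?thesis by (simp add: da_expansion_def)
qed

lift_definition da_of_poly :: "complex poly poly \<Rightarrow> drury_arveson"
  is "\<lambda>p z. if z \<in> ball 0 1 then poly2 p z else 0"
  using da_expansion_poly2 by blast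

abbreviation da_monom :: "nat \<Rightarrow> nat \<Rightarrow> drury_arveson" where
  "da_monom m n \<equiv> da_of_poly (monom (monom 1 m) n)"

lemma da_coeff_of_poly: "da_coeff (da_of_poly p) = (\<lambda>(m, n). coeff (coeff p n) m)"
  by (rule da_coeff_eqI, unfold da_of_poly.rep_eq) (rule da_expansion_poly2)

lemma da_cinner_monom:
  "da_cinner (da_monom m n) (da_monom m' n') = (if (m, n) = (m', n') then of_real (da_weight m n) else 0)"
proof -
  have "da_cinner (da_monom m n) (da_monom m' n') =
      (\<Sum>\<^sub>\<infinity>p\<in>{(m, n)}. if (m, n) = (m', n') then of_real (da_weight m n) else 0)"
    unfolding da_cinner_def da_coeff_of_poly by (rule infsum_cong_neutral) (auto simp: coeff_monom split: if_splits)
  then show ?thesis by simp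
qed

definition da_orth :: "drury_arveson set \<Rightarrow> drury_arveson set" where
  "da_orth A = {f. \<forall>g\<in>A. da_cinner f g = 0}"

text \<open>For a closed subspace \<open>V\<close> the \<open>THE\<close> is justified by the projection theorem.\<close>

definition da_proj :: "drury_arveson set \<Rightarrow> drury_arveson \<Rightarrow> drury_arveson" where
  "da_proj V f = (THE g. g \<in> V \<and> f - g \<in> da_orth V)"

definition da_unitary :: "drury_arveson set \<Rightarrow> drury_arveson set \<Rightarrow> (drury_arveson \<Rightarrow> drury_arveson) \<Rightarrow> bool" where
  "da_unitary V W U \<longleftrightarrow>
     (\<forall>f\<in>V. \<forall>g\<in>V. U (f + g) = U f + U g) \<and>
     (\<forall>a. \<forall>f\<in>V. U (a *\<^sub>C f) = a *\<^sub>C U f) \<and>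
     bij_betw U V W \<and>
     (\<forall>f\<in>V. \<forall>g\<in>V. da_cinner (U f) (U g) = da_cinner f g)"

text \<open>\<^const>\<open>DA.span\<close> is the complex linear span.\<close>

definition da_orthonormal_basis :: "'i set \<Rightarrow> ('i \<Rightarrow> drury_arveson) \<Rightarrow> drury_arveson set \<Rightarrow> bool" where
  "da_orthonormal_basis A e V \<longleftrightarrow>
     (\<forall>i\<in>A. \<forall>j\<in>A. da_cinner (e i) (e j) = (if i = j then 1 else 0)) \<and>
     closure (DA.span (e ` A)) = V"

definition smooth_curve :: "(real \<Rightarrow> 'a::real_normed_vector) \<Rightarrow> bool" where
  "smooth_curve \<xi> \<longleftrightarrow>
     (\<forall>n t. ((\<lambda>\<eta> s. vector_derivative \<eta> (at s)) ^^ n) \<xi> differentiable (at t))"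

definition ideal_t :: "nat \<Rightarrow> real \<Rightarrow> real \<Rightarrow> complex poly poly set" where
  "ideal_t k \<epsilon> t = range (\<lambda>q. [:monom 1 k - [:of_real \<epsilon> * cis t:]:] * q)"

definition fibre :: "nat \<Rightarrow> real \<Rightarrow> real \<Rightarrow> drury_arveson set" where
  "fibre k \<epsilon> t = da_orth (da_of_poly ` ideal_t k \<epsilon> t)"

definition smooth_sections :: "nat \<Rightarrow> real \<Rightarrow> (real \<Rightarrow> drury_arveson) set" where
  "smooth_sections k \<epsilon> = {\<xi>. smooth_curve \<xi> \<and> (\<forall>t. \<xi> t \<in> fibre k \<epsilon> t)}"

definition connection :: "nat \<Rightarrow> real \<Rightarrow> (real \<Rightarrow> drury_arveson) \<Rightarrow> real \<Rightarrow> drury_arveson" where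
  "connection k \<epsilon> \<xi> t = da_proj (fibre k \<epsilon> t) (vector_derivative \<xi> (at t))"

definition flat_section :: "nat \<Rightarrow> real \<Rightarrow> (real \<Rightarrow> drury_arveson) \<Rightarrow> bool" where
  "flat_section k \<epsilon> \<xi> \<longleftrightarrow> \<xi> \<in> smooth_sections k \<epsilon> \<and> (\<forall>t. connection k \<epsilon> \<xi> t = 0)"

text \<open>A smooth flat section need not exist for every initial value in the fibre over \<open>0\<close>: the
  norms of the derivatives of the flat frame sections are unbounded, so a flat section with
  square-summable frame coefficients is in general continuous but not differentiable.  As usual
  for evolution equations with unbounded generator, solutions for arbitrary initial values are
  uniform limits of smooth solutions.\<close>

definition solution :: "nat \<Rightarrow> real \<Rightarrow> (real \<Rightarrow> drury_arveson) \<Rightarrow> bool" where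
  "solution k \<epsilon> \<xi> \<longleftrightarrow>
     (\<exists>X. (\<forall>i. flat_section k \<epsilon> (X i)) \<and> uniform_limit UNIV X \<xi> sequentially)"

definition solution_operator :: "nat \<Rightarrow> real \<Rightarrow> real \<Rightarrow> drury_arveson \<Rightarrow> drury_arveson" where
  "solution_operator k \<epsilon> t \<xi>\<^sub>0 = (THE \<xi>. solution k \<epsilon> \<xi> \<and> \<xi> 0 = \<xi>\<^sub>0) t"

definition J :: "nat \<Rightarrow> (nat \<times> nat) set" where
  "J k = {(r, n). r \<le> k - 1}"

definition F :: "nat \<Rightarrow> real \<Rightarrow> real" where
  "F k \<epsilon> = \<epsilon> powr (2 / real k)"

definition zeta :: "nat \<Rightarrow> nat \<Rightarrow> complex" where
  "zeta k j = cis (2 * pi * real j / real k)"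

definition acoef :: "nat \<Rightarrow> real \<Rightarrow> nat \<Rightarrow> complex" where
  "acoef k \<epsilon> j = 1 - zeta k j * of_real (F k \<epsilon>)"

text \<open>The series below is a sum in the norm of \<^typ>\<open>drury_arveson\<close>.\<close>

definition alpha :: "nat \<Rightarrow> real \<Rightarrow> nat \<Rightarrow> nat \<Rightarrow> real \<Rightarrow> drury_arveson" where
  "alpha k \<epsilon> r n t = (\<Sum>\<^sub>\<infinity>q.
     (of_real (inverse (da_weight (r + k * q) n) * \<epsilon> ^ q) * cis (- (real q * t)))
       *\<^sub>C da_monom (r + k * q) n)"

definition beta :: "nat \<Rightarrow> real \<Rightarrow> nat \<Rightarrow> nat \<Rightarrow> real \<Rightarrow> drury_arveson" where
  "beta k \<epsilon> r n t = alpha k \<epsilon> r n t /\<^sub>R norm (alpha k \<epsilon> r n t)"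

definition freq :: "nat \<Rightarrow> real \<Rightarrow> nat \<Rightarrow> nat \<Rightarrow> real" where
  "freq k \<epsilon> r n =
     (\<Sum>\<^sub>\<infinity>q. inverse (da_weight (r + k * q) n) * real q * \<epsilon> ^ (2 * q)) /
     (\<Sum>\<^sub>\<infinity>q. inverse (da_weight (r + k * q) n) * \<epsilon> ^ (2 * q))"

definition gamma :: "nat \<Rightarrow> real \<Rightarrow> nat \<Rightarrow> nat \<Rightarrow> real \<Rightarrow> drury_arveson" where
  "gamma k \<epsilon> r n t = cis (freq k \<epsilon> r n * t) *\<^sub>C beta k \<epsilon> r n t"

end

theory Submission
  imports Defs
begin

text \<open>
  A function lies in the fibre over \<open>t\<close> iff its coefficients satisfy
  \<open>\<omega>\<^bsub>m+k,n\<^esub> c\<^bsub>m+k,n\<^esub> = \<epsilon> e\<^bsup>-it\<^esup> \<omega>\<^bsub>m,n\<^esub> c\<^bsub>m,n\<^esub>\<close>.  Hence the diagonal unitary group \<open>V\<^sub>t\<close> that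
  multiplies the coefficient at \<open>(r + kq, n)\<close>, \<open>0 \<le> r < k\<close>, by \<open>e\<^bsup>i(f\<^bsub>r,n\<^esub> - q)t\<^esup>\<close> maps the fibre
  over \<open>s\<close> onto the fibre over \<open>s + t\<close>, and \<open>\<gamma>\<^bsub>r,n\<^esub>(t) = V\<^sub>t \<beta>\<^bsub>r,n\<^esub>(0)\<close>.  The choice of \<open>f\<^bsub>r,n\<^esub>\<close> is exactly
  what makes the generator of \<open>V\<^sub>t\<close> map rapidly decreasing elements of the fibre into its orthogonal
  complement, so that \<open>V\<^sub>t\<close> moves them along flat sections.  The difference of two flat sections has
  constant norm; comparing a flat section with the orbits of truncations of its initial value, one
  sees that every flat section, and then every uniform limit of flat sections, is an orbit of
  \<open>V\<^sub>t\<close>.  The closed form of \<open>f\<^bsub>r,n\<^esub>\<close> is obtained by filtering the negative binomial series with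
  \<open>k\<close>-th roots of unity, and its asymptotics hold because \<open>|a\<^sub>j| > a\<^sub>0 = 1 - F\<close> for \<open>j \<noteq> 0\<close>.
\<close>

section \<open>Frequencies\<close>

text \<open>Induction on the exponent: differentiating the series for \<open>N\<close> termwise
  gives the coefficients \<open>(m + 1) * (m + 2) ^ N\<close>, which dominate
  \<open>(m + 1) ^ (N + 1)\<close>, and the differentiated series converges wherever the original
  one does in the open unit disc.\<close>

lemma summable_Suc_power_mult_power:
  fixes x :: real
  assumes "0 \<le> x" "x < 1"
  shows "summable (\<lambda>m. real (Suc m) ^ N * x ^ m)"
  using assms
proof (induction N arbitrary: x)
  case 0
  then show ?case by simp
next
  case (Suc N)
  obtain y where y: "x < y" "y < 1"
    using dense[OF Suc.prems(2)] by blast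
  have "summable (\<lambda>m. diffs (\<lambda>m. real (Suc m) ^ N) m * x ^ m)"
  proof (rule termdiff_converges[where K = 1])
    fix z :: real assume "norm z < 1"
    then have "summable (\<lambda>m. real (Suc m) ^ N * \<bar>z\<bar> ^ m)"
      by (intro Suc.IH) auto
    then have "summable (\<lambda>m. norm (real (Suc m) ^ N * z ^ m))"
      by (simp add: abs_mult power_abs del: of_nat_Suc)
    then show "summable (\<lambda>m. real (Suc m) ^ N * z ^ m)"
      by (rule summable_norm_cancel)
  qed (use Suc.prems in auto)
  then show ?case
  proof (rule summable_comparison_test')
    fix m :: nat
    have "real (Suc m) ^ N \<le> real (Suc (Suc m)) ^ N"
      by (intro power_mono) auto
    then show "norm (real (Suc m) ^ Suc N * x ^ m) \<le> diffs (\<lambda>m. real (Suc m) ^ N) m * x ^ m"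
      using Suc.prems by (simp add: diffs_def mult_left_mono mult_right_mono)
  qed
qed

text \<open>For fixed \<open>n\<close> the binomial coefficient grows polynomially in
  \<open>m\<close>; this crude bound suffices because it is always paired with a geometric
  factor.\<close>

lemma choose_le_Suc_power: "real ((m + n) choose m) \<le> real (Suc n) ^ n * real (Suc m) ^ n"
proof -
  have "(m + n) choose m = (m + n) choose n"
    by (subst binomial_symmetric) auto
  also have "\<dots> \<le> (m + n) ^ n"
    by (cases "n \<le> m + n") (auto intro: binomial_le_pow)
  also have "\<dots> \<le> (Suc n * Suc m) ^ n"
    by (intro power_mono) auto
  finally have "(m + n) choose m \<le> Suc n ^ n * Suc m ^ n"
    by (simp only: power_mult_distrib)
  then have "real ((m + n) choose m) \<le> real (Suc n ^ n * Suc m ^ n)"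
    by (rule of_nat_mono)
  then show ?thesis by simp
qed

lemma neg_binomial_abs_summable:
  fixes y :: complex
  assumes "norm y < 1"
  shows "summable (\<lambda>m. norm (of_nat ((m + n) choose m) * y ^ m))"
proof (rule summable_comparison_test')
  show "summable (\<lambda>m. real (Suc n) ^ n * (real (Suc m) ^ n * norm y ^ m))"
    using assms by (intro summable_mult summable_Suc_power_mult_power) auto
  show "norm (norm (of_nat ((m + n) choose m) * y ^ m)) \<le> real (Suc n) ^ n * (real (Suc m) ^ n * norm y ^ m)" for m
    using mult_right_mono[OF choose_le_Suc_power[of m n], of "norm y ^ m"]
    by (simp add: norm_mult norm_power mult_ac)
qed

text \<open>Induction on \<open>n\<close>: multiplying the series for \<open>n + 1\<close> by
  \<open>1 - y\<close> gives, by Pascal's rule, the series for \<open>n\<close>.\<close>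

lemma neg_binomial_sums:
  fixes y :: complex
  assumes "norm y < 1"
  shows "(\<lambda>m. of_nat ((m + n) choose m) * y ^ m) sums inverse ((1 - y) ^ Suc n)"
proof (induction n)
  case 0
  then show ?case using geometric_sums[OF assms] by (simp add: field_simps)
next
  case (Suc n)
  define f where "f = (\<lambda>m. of_nat ((m + Suc n) choose m) * y ^ m)"
  have y: "1 - y \<noteq> 0" using assms by auto
  have f: "f sums suminf f"
    unfolding f_def by (intro summable_sums summable_norm_cancel[OF neg_binomial_abs_summable] assms)
  \<comment> \<open>The product of \<open>y\<close> with the series, written as the series shifted
    by one place with leading term 0, so that it can be subtracted term by term.\<close>
  have "(\<lambda>m. (case m of 0 \<Rightarrow> 0 | Suc m \<Rightarrow> y * f m)) sums (y * suminf f)"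
    using sums_mult[OF f, of y] sums_Suc_iff[of "\<lambda>m. case m of 0 \<Rightarrow> 0 | Suc m \<Rightarrow> y * f m" "y * suminf f"] by simp
  then have "(\<lambda>m. f m - (case m of 0 \<Rightarrow> 0 | Suc m \<Rightarrow> y * f m)) sums (suminf f - y * suminf f)"
    by (rule sums_diff[OF f])
  moreover have "f m - (case m of 0 \<Rightarrow> 0 | Suc m \<Rightarrow> y * f m) = of_nat ((m + n) choose m) * y ^ m" for m
    by (cases m) (auto simp: f_def algebra_simps)
  ultimately have "suminf f - y * suminf f = inverse ((1 - y) ^ Suc n)"
    using Suc.IH sums_unique2 by simp
  then have "(1 - y) * suminf f = inverse ((1 - y) ^ Suc n)"
    by (simp only: left_diff_distrib mult_1)
  then have "suminf f = inverse (1 - y) * inverse ((1 - y) ^ Suc n)"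
    using y by (metis mult.assoc left_inverse mult_1)
  then have "suminf f = inverse ((1 - y) ^ Suc (Suc n))"
    by (simp only: power_Suc inverse_mult_distrib)
  then show ?case using f by (simp add: f_def)
qed

lemma neg_binomial_has_sum:
  fixes y :: complex
  assumes "norm y < 1"
  shows "((\<lambda>m. of_nat ((m + n) choose m) * y ^ m) has_sum (1 - y) powi (- int n - 1)) UNIV"
proof -
  have "inverse ((1 - y) ^ Suc n) = (1 - y) powi (- int n - 1)"
    using assms by (simp add: power_int_def nat_add_distrib power_inverse)
  then show ?thesis
    using norm_summable_imp_has_sum[OF neg_binomial_abs_summable[OF assms] neg_binomial_sums[OF assms], of n] by simp
qed

text \<open>The absorption identity
  \<open>(m + 1) * C(m + 1 + n, m + 1) = (n + 1) * C(m + n + 1, m)\<close> turns the series, whose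
  term at \<open>m = 0\<close> vanishes, into \<open>(n + 1) * y\<close> times the negative binomial
  series for \<open>n + 1\<close>.\<close>

lemma neg_binomial_deriv_has_sum:
  fixes y :: complex
  assumes "norm y < 1"
  shows "((\<lambda>m. of_nat m * (of_nat ((m + n) choose m) * y ^ m))
    has_sum of_nat (Suc n) * y * (1 - y) powi (- int n - 2)) UNIV"
proof -
  let ?f = "\<lambda>m. of_nat m * (of_nat ((m + n) choose m) * y ^ m)"
  have Suc: "?f (Suc m) = of_nat (Suc n) * y * (of_nat ((m + Suc n) choose m) * y ^ m)" for m
  proof -
    have "Suc m * ((Suc m + n) choose Suc m) = Suc n * ((m + Suc n) choose m)"
      by (metis Suc_times_binomial_add add_Suc add_Suc_right)
    then have "complex_of_nat (Suc m * ((Suc m + n) choose Suc m)) = of_nat (Suc n * ((m + Suc n) choose m))"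
      by (rule arg_cong)
    then have "of_nat (Suc m) * complex_of_nat ((Suc m + n) choose Suc m)
      = of_nat (Suc n) * of_nat ((m + Suc n) choose m)"
      by (simp only: of_nat_mult)
    then show ?thesis
      by (simp only: power_Suc mult_ac) (metis mult.assoc mult.commute)
  qed
  have "((\<lambda>m. of_nat (Suc n) * y * (of_nat ((m + Suc n) choose m) * y ^ m))
      has_sum of_nat (Suc n) * y * (1 - y) powi (- int (Suc n) - 1)) UNIV"
    by (intro has_sum_cmult_right neg_binomial_has_sum assms)
  then have "((\<lambda>m. ?f (Suc m)) has_sum of_nat (Suc n) * y * (1 - y) powi (- int n - 2)) UNIV"
    by (simp only: Suc) (simp add: algebra_simps)
  then have "(?f has_sum of_nat (Suc n) * y * (1 - y) powi (- int n - 2)) (range Suc)"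
    by (subst has_sum_reindex) (auto simp: o_def)
  then show ?thesis
  proof (rule has_sum_cong_neutral[THEN iffD1, rotated -1])
    show "?f m = 0" if "m \<in> UNIV - range Suc" for m
      using that by (cases m) auto
  qed auto
qed

section \<open>Averaging over roots of unity\<close>

lemma has_sum_sum:
  fixes f :: "'i \<Rightarrow> 'a \<Rightarrow> 'b::topological_comm_monoid_add"
  assumes "\<And>i. i \<in> I \<Longrightarrow> (f i has_sum S i) A"
  shows "((\<lambda>x. \<Sum>i\<in>I. f i x) has_sum (\<Sum>i\<in>I. S i)) A"
  using assms by (induction I rule: infinite_finite_induct) (auto intro: has_sum_add)

lemma zeta_powi: "zeta k j powi s = cis (2 * pi * real_of_int s / real k) ^ j"
  by (simp add: zeta_def cis_power_int Complex.DeMoivre) (simp add: mult_ac)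

lemma cis_eq_1_iff: "cis x = 1 \<longleftrightarrow> (\<exists>i::int. x = 2 * pi * of_int i)"
  by (auto simp: complex_eq_iff cos_one_2pi_int)

text \<open>The sum is geometric with ratio \<open>w = exp(2 pi i s / k)\<close>; since
  \<open>w ^ k = 1\<close>, it vanishes unless \<open>w = 1\<close>, which means that
  \<open>k\<close> divides \<open>s\<close>.\<close>

lemma sum_zeta_powi:
  assumes "k \<ge> 1"
  shows "(\<Sum>j<k. zeta k j powi s) = (if int k dvd s then of_nat k else 0)"
proof -
  define w where "w = cis (2 * pi * real_of_int s / real k)"
  have 1: "w = 1 \<longleftrightarrow> int k dvd s"
  proof -
    have "(2 * pi * real_of_int s / real k = 2 * pi * of_int i) \<longleftrightarrow> s = int k * i" for i
    proof -
      have "(2 * pi * real_of_int s / real k = 2 * pi * of_int i) \<longleftrightarrow> real_of_int s = real_of_int (int k * i)"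
        using assms by (simp add: field_simps)
      then show ?thesis by (simp only: of_int_eq_iff)
    qed
    then show ?thesis by (simp add: w_def cis_eq_1_iff dvd_def)
  qed
  have "w ^ k = cis (2 * pi * of_int s)"
    using assms by (simp add: w_def Complex.DeMoivre del: cis_multiple_2pi)
  then have wk: "w ^ k = 1" by simp
  have "(\<Sum>j<k. zeta k j powi s) = (\<Sum>j<k. w ^ j)"
    by (simp add: zeta_powi w_def)
  also have "\<dots> = (if int k dvd s then of_nat k else 0)"
    using 1 wk by (auto simp: geometric_sum)
  finally show ?thesis .
qed

lemma norm_zeta [simp]: "norm (zeta k j) = 1"
  by (simp add: zeta_def)

lemma zeta_nonzero [simp]: "zeta k j \<noteq> 0"
  by (metis norm_zeta norm_zero zero_neq_one)

text \<open>Averaging over the \<open>k\<close>-th roots of unity extracts the residue class \<open>r\<close> modulo \<open>k\<close>.\<close>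

lemma has_sum_residue_class:
  fixes c :: "nat \<Rightarrow> complex"
  assumes k: "k \<ge> 1" and r: "r < k"
    and h: "\<And>j. j < k \<Longrightarrow> ((\<lambda>m. c m * (zeta k j * y) ^ m) has_sum S j) UNIV"
  shows "((\<lambda>q. of_nat k * (c (r + k * q) * y ^ (r + k * q))) has_sum
    (\<Sum>j<k. zeta k j powi (- int r) * S j)) UNIV"
proof -
  have "((\<lambda>m. \<Sum>j<k. zeta k j powi (- int r) * (c m * (zeta k j * y) ^ m)) has_sum
    (\<Sum>j<k. zeta k j powi (- int r) * S j)) UNIV"
    by (intro has_sum_sum has_sum_cmult_right h) auto
  moreover have "(\<Sum>j<k. zeta k j powi (- int r) * (c m * (zeta k j * y) ^ m))
    = (if m \<in> range (\<lambda>q. r + k * q) then of_nat k * (c m * y ^ m) else 0)" for m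
  proof -
    have *: "zeta k j powi (- int r) * (c m * (zeta k j * y) ^ m)
        = zeta k j powi (int m - int r) * (c m * y ^ m)" for j
      by (simp add: power_mult_distrib power_int_diff power_int_minus field_simps)
    \<comment> \<open>As \<open>r < k\<close>, the congruence forces \<open>m mod k = r\<close>,
      hence \<open>m >= r\<close> and the quotient is a natural number.\<close>
    have "int k dvd int m - int r \<longleftrightarrow> m \<in> range (\<lambda>q. r + k * q)"
    proof
      assume "int k dvd int m - int r"
      then have "int m mod int k = int r mod int k" by (simp add: mod_eq_dvd_iff)
      then have "m mod k = r" using r by (simp add: zmod_int[symmetric])
      then have "m = r + k * (m div k)" by (metis mod_mult_div_eq)
      then show "m \<in> range (\<lambda>q. r + k * q)" by blast
    qed auto
    then show ?thesis
      unfolding * sum_distrib_right[symmetric] sum_zeta_powi[OF k] by simp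
  qed
  ultimately have "((\<lambda>m. if m \<in> range (\<lambda>q. r + k * q) then of_nat k * (c m * y ^ m) else 0) has_sum
    (\<Sum>j<k. zeta k j powi (- int r) * S j)) UNIV"
    by simp
  then have "((\<lambda>m. of_nat k * (c m * y ^ m)) has_sum
    (\<Sum>j<k. zeta k j powi (- int r) * S j)) (range (\<lambda>q. r + k * q))"
    by (rule has_sum_cong_neutral[THEN iffD1, rotated -1]) auto
  moreover have "inj (\<lambda>q. r + k * q)"
    using k by (auto simp: inj_def)
  ultimately show ?thesis
    by (subst (asm) has_sum_reindex) (auto simp: o_def)
qed

section \<open>Frame weights, their first moments and the closed form of the frequency\<close>

lemma F_bounds:
  assumes "k \<ge> 1" "0 < \<epsilon>" "\<epsilon> < 1"
  shows "0 < F k \<epsilon>" "F k \<epsilon> < 1"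
  using assms powr_less_mono2[of "2 / real k" \<epsilon> 1] by (auto simp: F_def)

text \<open>\<open>F\<close> is the \<open>k\<close>-th root of the square of
  \<open>\<epsilon>\<close>. Hence a power series in \<open>F\<close>, restricted to exponents
  \<open>r + k * q\<close>, becomes \<open>F ^ r\<close> times a power series in the square of
  \<open>\<epsilon>\<close>.\<close>

lemma F_power:
  assumes "k \<ge> 1" "0 < \<epsilon>"
  shows "F k \<epsilon> ^ k = \<epsilon>\<^sup>2"
proof -
  have "F k \<epsilon> ^ k = F k \<epsilon> powr real k"
    using assms by (subst powr_realpow) (auto simp: F_def)
  also have "\<dots> = \<epsilon> powr real 2"
    using assms by (simp add: F_def powr_powr)
  finally show ?thesis using assms by (simp only: powr_realpow)
qed

lemma inverse_da_weight: "inverse (da_weight m n) = real ((m + n) choose m)"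
  by (simp add: da_weight_def)

text \<open>The contribution of the monomial with exponents \<open>(r + k * q, n)\<close> to the
  squared norm of \<open>alpha k \<epsilon> r n t\<close>: the weight times the squared modulus of
  the coefficient.\<close>

definition frame_weight :: "nat \<Rightarrow> real \<Rightarrow> nat \<Rightarrow> nat \<Rightarrow> nat \<Rightarrow> real" where
  "frame_weight k \<epsilon> r n q = inverse (da_weight (r + k * q) n) * \<epsilon> ^ (2 * q)"

text \<open>Both identities extract the residue class \<open>r\<close> from a series at the points
  \<open>zeta k j * F k \<epsilon>\<close>: the negative binomial series for the first, its
  derivative for the second. The factor \<open>zeta k j\<close> from the derivative raises the
  exponent \<open>- r\<close> to \<open>- r + 1\<close>.\<close>

lemma frame_weight_sums:
  assumes k: "k \<ge> 1" and e: "0 < \<epsilon>" "\<epsilon> < 1" and r: "r < k"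
  shows "((\<lambda>q. complex_of_real (real k * F k \<epsilon> ^ r * frame_weight k \<epsilon> r n q)) has_sum
      (\<Sum>j<k. zeta k j powi (- int r) * acoef k \<epsilon> j powi (- int n - 1))) UNIV" (is ?A)
    and "((\<lambda>q. complex_of_real (real k * F k \<epsilon> ^ r * (real (r + k * q) * frame_weight k \<epsilon> r n q))) has_sum
      (of_real (F k \<epsilon>) * (of_nat n + 1)
        * (\<Sum>j<k. zeta k j powi (- int r + 1) * acoef k \<epsilon> j powi (- int n - 2)))) UNIV" (is ?B)
proof -
  note F = F_bounds[OF k e]
  have pow: "F k \<epsilon> ^ (r + k * q) = F k \<epsilon> ^ r * \<epsilon> ^ (2 * q)" for q
    using F_power[OF k e(1)] by (simp add: power_add power_mult)
  have cpow: "of_real (F k \<epsilon>) ^ (r + k * q) = of_real (F k \<epsilon> ^ r) * complex_of_real (\<epsilon> ^ (2 * q))" for q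
    unfolding of_real_power[symmetric] of_real_mult[symmetric] pow ..
  have n1: "norm (zeta k j * of_real (F k \<epsilon>)) < 1" for j
    using F by (simp add: norm_mult)
  have "((\<lambda>q. of_nat k * (of_nat ((r + k * q + n) choose (r + k * q)) * of_real (F k \<epsilon>) ^ (r + k * q))) has_sum
      (\<Sum>j<k. zeta k j powi (- int r) * acoef k \<epsilon> j powi (- int n - 1))) UNIV"
    unfolding acoef_def by (intro has_sum_residue_class k r neg_binomial_has_sum n1)
  then show ?A
    unfolding frame_weight_def inverse_da_weight of_real_mult of_real_of_nat_eq cpow by (simp only: mult_ac)
  have *: "((\<lambda>m. of_nat m * of_nat ((m + n) choose m) * (zeta k j * of_real (F k \<epsilon>)) ^ m) has_sum
      of_nat (Suc n) * (zeta k j * of_real (F k \<epsilon>)) * acoef k \<epsilon> j powi (- int n - 2)) UNIV" for j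
    using neg_binomial_deriv_has_sum[OF n1, of n j] by (simp only: acoef_def mult.assoc)
  have "((\<lambda>q. of_nat k * (of_nat (r + k * q) * of_nat ((r + k * q + n) choose (r + k * q)) * of_real (F k \<epsilon>) ^ (r + k * q))) has_sum
      (\<Sum>j<k. zeta k j powi (- int r) * (of_nat (Suc n) * (zeta k j * of_real (F k \<epsilon>)) * acoef k \<epsilon> j powi (- int n - 2)))) UNIV"
    by (intro has_sum_residue_class k r *)
  also have "(\<Sum>j<k. zeta k j powi (- int r) * (of_nat (Suc n) * (zeta k j * of_real (F k \<epsilon>)) * acoef k \<epsilon> j powi (- int n - 2)))
    = of_real (F k \<epsilon>) * (of_nat n + 1)
        * (\<Sum>j<k. zeta k j powi (- int r + 1) * acoef k \<epsilon> j powi (- int n - 2))"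
    unfolding sum_distrib_left
    by (intro sum.cong refl) (simp only: power_int_add_1 zeta_nonzero simp_thms of_nat_Suc mult_ac add.commute[of 1])
  finally show ?B
    unfolding frame_weight_def inverse_da_weight of_real_mult of_real_of_nat_eq cpow by (simp only: mult_ac)
qed

text \<open>\<open>A\<close> is the total mass of the frame weights and \<open>freq * A\<close>
  their first moment, so the frequency is the mean of \<open>q\<close>. The last two equations
  express the mass and the moment of \<open>r + k * q\<close> by sums over roots of unity.\<close>

lemma frame_weight_has_sum:
  assumes k: "k \<ge> 1" and e: "0 < \<epsilon>" "\<epsilon> < 1" and r: "r < k"
  obtains A where "A > 0" "(frame_weight k \<epsilon> r n has_sum A) UNIV"
    "((\<lambda>q. frame_weight k \<epsilon> r n q * real q) has_sum (freq k \<epsilon> r n * A)) UNIV"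
    "complex_of_real (real k * F k \<epsilon> ^ r * A)
      = (\<Sum>j<k. zeta k j powi (- int r) * acoef k \<epsilon> j powi (- int n - 1))"
    "complex_of_real (real k * F k \<epsilon> ^ r * (real r * A + real k * (freq k \<epsilon> r n * A)))
      = of_real (F k \<epsilon>) * (of_nat n + 1)
        * (\<Sum>j<k. zeta k j powi (- int r + 1) * acoef k \<epsilon> j powi (- int n - 2))"
proof -
  note F = F_bounds[OF k e]
  define w where "w = frame_weight k \<epsilon> r n"
  have K: "real k * F k \<epsilon> ^ r \<noteq> 0" using k F by auto
  note S = frame_weight_sums[OF k e r, of n, folded w_def]
  have wpos: "w q > 0" for q
    using e by (auto simp: w_def frame_weight_def)
  have sw: "w summable_on UNIV"
  proof -
    have "(\<lambda>q. real k * F k \<epsilon> ^ r * w q) summable_on UNIV"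
      using has_sum_Re[OF S(1)] by (auto simp: summable_on_def)
    then show ?thesis using K by (subst (asm) summable_on_cmult_right') auto
  qed
  have srw: "(\<lambda>q. real (r + k * q) * w q) summable_on UNIV"
  proof -
    have "(\<lambda>q. real k * F k \<epsilon> ^ r * (real (r + k * q) * w q)) summable_on UNIV"
      using has_sum_Re[OF S(2)] by (auto simp: summable_on_def)
    then show ?thesis using K by (subst (asm) summable_on_cmult_right') auto
  qed
  define A where "A = infsum w UNIV"
  define B where "B = infsum (\<lambda>q. w q * real q) UNIV"
  have A: "(w has_sum A) UNIV" unfolding A_def using sw by simp
  \<comment> \<open>Removing \<open>r\<close> times the mass from the moment of
    \<open>r + k * q\<close> isolates the moment of \<open>q\<close>.\<close>
  have "(\<lambda>q. real (r + k * q) * w q + (- real r) * w q) summable_on UNIV"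
    by (intro summable_on_add srw summable_on_cmult_right sw)
  then have "(\<lambda>q. real k * (w q * real q)) summable_on UNIV"
    by (simp add: algebra_simps)
  then have "(\<lambda>q. w q * real q) summable_on UNIV"
    using k by (subst (asm) summable_on_cmult_right') auto
  then have B: "((\<lambda>q. w q * real q) has_sum B) UNIV" unfolding B_def by simp
  have "w 0 \<le> A"
    using finite_sum_le_has_sum[OF A, of "{0}"] wpos by (auto simp: less_imp_le)
  then have Apos: "A > 0" using wpos[of 0] by linarith
  have "freq k \<epsilon> r n = B / A"
    by (simp add: freq_def A_def B_def w_def frame_weight_def[abs_def] mult.assoc mult.commute mult.left_commute)
  then have fA: "freq k \<epsilon> r n * A = B" using Apos by simp
  show ?thesis
  proof (rule that[OF Apos A[unfolded w_def]])
    show "((\<lambda>q. frame_weight k \<epsilon> r n q * real q) has_sum (freq k \<epsilon> r n * A)) UNIV"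
      using B by (simp add: fA w_def)
    have "((\<lambda>q. complex_of_real (real k * F k \<epsilon> ^ r * w q)) has_sum
        of_real (real k * F k \<epsilon> ^ r * A)) UNIV"
      by (intro has_sum_of_real has_sum_cmult_right A)
    with S(1) show "complex_of_real (real k * F k \<epsilon> ^ r * A)
      = (\<Sum>j<k. zeta k j powi (- int r) * acoef k \<epsilon> j powi (- int n - 1))"
      using has_sum_unique by blast
    have "((\<lambda>q. real r * w q + real k * (w q * real q)) has_sum (real r * A + real k * B)) UNIV"
      by (intro has_sum_add has_sum_cmult_right A B)
    then have "((\<lambda>q. real (r + k * q) * w q) has_sum (real r * A + real k * B)) UNIV"
      by (simp add: algebra_simps)
    then have "((\<lambda>q. complex_of_real (real k * F k \<epsilon> ^ r * (real (r + k * q) * w q))) has_sum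
        of_real (real k * F k \<epsilon> ^ r * (real r * A + real k * B))) UNIV"
      by (intro has_sum_of_real has_sum_cmult_right)
    with S(2) show "complex_of_real (real k * F k \<epsilon> ^ r * (real r * A + real k * (freq k \<epsilon> r n * A)))
      = of_real (F k \<epsilon>) * (of_nat n + 1)
        * (\<Sum>j<k. zeta k j powi (- int r + 1) * acoef k \<epsilon> j powi (- int n - 2))"
      unfolding fA using has_sum_unique by blast
  qed
qed

text \<open>The moment of \<open>r + k * q\<close>, less \<open>r\<close> times the mass, divided by
  \<open>k\<close> times the mass, is the mean of \<open>q\<close>; the common factor
  \<open>k * F ^ r\<close> cancels. The second fact shows that the quotient is a genuine one: its
  denominator comes from a positive mass.\<close>

lemma freq_closed_form:
  assumes k: "k \<ge> 1" and e: "0 < \<epsilon>" "\<epsilon> < 1" and r: "r < k"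
  shows "complex_of_real (freq k \<epsilon> r n) =
    (- of_nat r * (\<Sum>j<k. zeta k j powi (- int r) * acoef k \<epsilon> j powi (- int n - 1))
     + of_real (F k \<epsilon>) * (of_nat n + 1)
       * (\<Sum>j<k. zeta k j powi (- int r + 1) * acoef k \<epsilon> j powi (- int n - 2)))
    / (of_nat k * (\<Sum>j<k. zeta k j powi (- int r) * acoef k \<epsilon> j powi (- int n - 1)))"
    and "(\<Sum>j<k. zeta k j powi (- int r) * acoef k \<epsilon> j powi (- int n - 1)) \<noteq> 0"
proof -
  obtain A where A: "A > 0"
    and "(frame_weight k \<epsilon> r n has_sum A) UNIV"
    and "((\<lambda>q. frame_weight k \<epsilon> r n q * real q) has_sum (freq k \<epsilon> r n * A)) UNIV"
    and 1: "complex_of_real (real k * F k \<epsilon> ^ r * A)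
      = (\<Sum>j<k. zeta k j powi (- int r) * acoef k \<epsilon> j powi (- int n - 1))"
    and 2: "complex_of_real (real k * F k \<epsilon> ^ r * (real r * A + real k * (freq k \<epsilon> r n * A)))
      = of_real (F k \<epsilon>) * (of_nat n + 1)
        * (\<Sum>j<k. zeta k j powi (- int r + 1) * acoef k \<epsilon> j powi (- int n - 2))"
    by (rule frame_weight_has_sum[OF assms, of n])
  have K: "real k * F k \<epsilon> ^ r * A \<noteq> 0" using k F_bounds[OF k e] A by auto
  show "(\<Sum>j<k. zeta k j powi (- int r) * acoef k \<epsilon> j powi (- int n - 1)) \<noteq> 0"
    unfolding 1[symmetric] of_real_eq_0_iff by (rule K)
  have gen: "(- r * K + c * (r * A + k * (f * A))) / (k * K) = f"
    if "k \<noteq> 0" "K \<noteq> 0" "K = c * A" for f r k K A c :: real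
    using that by (simp add: divide_eq_eq algebra_simps)
  have "(- real r * (real k * F k \<epsilon> ^ r * A)
      + real k * F k \<epsilon> ^ r * (real r * A + real k * (freq k \<epsilon> r n * A)))
    / (real k * (real k * F k \<epsilon> ^ r * A)) = freq k \<epsilon> r n"
    by (rule gen) (use K k in auto)
  from arg_cong[OF this, of complex_of_real]
  show "complex_of_real (freq k \<epsilon> r n) =
    (- of_nat r * (\<Sum>j<k. zeta k j powi (- int r) * acoef k \<epsilon> j powi (- int n - 1))
     + of_real (F k \<epsilon>) * (of_nat n + 1)
       * (\<Sum>j<k. zeta k j powi (- int r + 1) * acoef k \<epsilon> j powi (- int n - 2)))
    / (of_nat k * (\<Sum>j<k. zeta k j powi (- int r) * acoef k \<epsilon> j powi (- int n - 1)))"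
    unfolding 1[symmetric] 2[symmetric]
    by (simp only: of_real_add of_real_divide of_real_minus of_real_mult of_real_of_nat_eq)
qed

section \<open>Asymptotics of the frequency\<close>

text \<open>The squared modulus is \<open>1 - 2 F Re(zeta) + F^2\<close>, and
  \<open>Re(zeta) < 1\<close> because \<open>zeta\<close> is a point of the unit circle different
  from 1 when \<open>0 < j < k\<close>.\<close>

lemma norm_acoef_gt:
  assumes e: "0 < \<epsilon>" "\<epsilon> < 1" and j: "0 < j" "j < k"
  shows "1 - F k \<epsilon> < norm (acoef k \<epsilon> j)"
proof -
  have F: "0 < F k \<epsilon>" "F k \<epsilon> < 1" using F_bounds[of k \<epsilon>] e j by auto
  have "zeta k j \<noteq> 1"
  proof
    assume "zeta k j = 1"
    then obtain i :: int where "2 * pi * real j / real k = 2 * pi * of_int i"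
      by (auto simp: zeta_def cis_eq_1_iff)
    then have "real_of_int (int j) = real_of_int (i * int k)"
      using j by (simp add: field_simps)
    then have "int j = i * int k" by (simp only: of_int_eq_iff)
    moreover have "int k dvd int j \<longleftrightarrow> k dvd j" by simp
    ultimately have "k dvd j" by simp
    with j show False by (auto dest: dvd_imp_le)
  qed
  have one: "(Re (zeta k j))\<^sup>2 + (Im (zeta k j))\<^sup>2 = 1"
    using cmod_power2[of "zeta k j"] by simp
  with \<open>zeta k j \<noteq> 1\<close> have "Re (zeta k j) \<noteq> 1"
    by (auto simp: complex_eq_iff)
  moreover have "Re (zeta k j) \<le> 1"
    using complex_Re_le_cmod[of "zeta k j"] by simp
  ultimately have re: "Re (zeta k j) < 1" by simp
  have "(norm (acoef k \<epsilon> j))\<^sup>2 = 1 - 2 * F k \<epsilon> * Re (zeta k j) + (F k \<epsilon>)\<^sup>2 * ((Re (zeta k j))\<^sup>2 + (Im (zeta k j))\<^sup>2)"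
    unfolding cmod_power2 by (simp add: acoef_def power2_eq_square algebra_simps)
  also have "\<dots> > (1 - F k \<epsilon>)\<^sup>2"
    unfolding one using mult_strict_left_mono[OF re F(1)] by (simp add: power2_eq_square algebra_simps)
  finally show ?thesis
    by (rule power2_less_imp_less) simp
qed

text \<open>After both sums in the closed form are scaled by powers of
  \<open>c = acoef k \<epsilon> 0\<close>, the term \<open>j = 0\<close> is constantly 1 and all
  others decay geometrically, fast enough to absorb the factor \<open>n + 1\<close>.\<close>

lemma freq_asymptotics:
  assumes k: "k \<ge> 1" and e: "0 < \<epsilon>" "\<epsilon> < 1" and r: "r < k"
  shows "(\<lambda>n. freq k \<epsilon> r n - (F k \<epsilon> / (real k * (1 - F k \<epsilon>)) * real n
      + F k \<epsilon> / (real k * (1 - F k \<epsilon>)) - real r / real k)) \<longlonglongrightarrow> 0"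
proof -
  note F = F_bounds[OF k e]
  define \<phi> where "\<phi> = complex_of_real (F k \<epsilon>)"
  define c where "c = 1 - \<phi>"
  have c_real: "c = complex_of_real (1 - F k \<epsilon>)" by (simp add: c_def \<phi>_def)
  have c0: "c \<noteq> 0" unfolding c_real of_real_eq_0_iff using F by simp
  define \<rho> where "\<rho> j = c / acoef k \<epsilon> j" for j
  \<comment> \<open>\<open>T1\<close> and \<open>T2\<close> are the sums of the closed form
    multiplied by \<open>c ^ (n + 1)\<close> and \<open>c ^ (n + 2)\<close>.\<close>
  define T1 where "T1 n = (\<Sum>j<k. zeta k j powi (- int r) * \<rho> j ^ (n + 1))" for n
  define T2 where "T2 n = (\<Sum>j<k. zeta k j powi (- int r + 1) * \<rho> j ^ (n + 2))" for n
  have a0: "acoef k \<epsilon> j \<noteq> 0" for j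
  proof
    assume "acoef k \<epsilon> j = 0"
    then have "norm (zeta k j * of_real (F k \<epsilon>)) = norm (1::complex)"
      unfolding acoef_def by (metis eq_iff_diff_eq_0)
    with F show False by (simp add: norm_mult)
  qed
  have S1: "(\<Sum>j<k. zeta k j powi (- int r) * acoef k \<epsilon> j powi (- int n - 1)) = T1 n / c ^ (n + 1)" for n
  proof -
    have "acoef k \<epsilon> j powi (- int n - 1) = \<rho> j ^ (n + 1) / c ^ (n + 1)" for j
    proof -
      have "- int n - 1 = - int (n + 1)" by simp
      then have "acoef k \<epsilon> j powi (- int n - 1) = inverse (acoef k \<epsilon> j ^ (n + 1))"
        by (simp only: power_int_minus power_int_of_nat)
      then show ?thesis using c0 by (simp add: \<rho>_def power_divide inverse_eq_divide)
    qed
    then show ?thesis by (simp only: T1_def sum_divide_distrib times_divide_eq_right)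
  qed
  have S2: "(\<Sum>j<k. zeta k j powi (- int r + 1) * acoef k \<epsilon> j powi (- int n - 2)) = T2 n / c ^ (n + 2)" for n
  proof -
    have "acoef k \<epsilon> j powi (- int n - 2) = \<rho> j ^ (n + 2) / c ^ (n + 2)" for j
    proof -
      have "- int n - 2 = - int (n + 2)" by simp
      then have "acoef k \<epsilon> j powi (- int n - 2) = inverse (acoef k \<epsilon> j ^ (n + 2))"
        by (simp only: power_int_minus power_int_of_nat)
      then show ?thesis using c0 by (simp add: \<rho>_def power_divide inverse_eq_divide)
    qed
    then show ?thesis by (simp only: T2_def sum_divide_distrib times_divide_eq_right)
  qed
  have T10: "T1 n \<noteq> 0" for n
    using freq_closed_form(2)[OF assms, of n] unfolding S1 by auto
  have \<rho>0: "\<rho> 0 = 1"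
    using c0 by (simp add: \<rho>_def acoef_def zeta_def c_def \<phi>_def)
  have \<rho>1: "norm (\<rho> j) < 1" if "0 < j" "j < k" for j
  proof -
    have "norm c = 1 - F k \<epsilon>"
      unfolding c_real norm_of_real using F by simp
    then show ?thesis
      using norm_acoef_gt[OF e that] a0[of j] by (simp add: \<rho>_def norm_divide)
  qed
  have lim0: "(\<lambda>n. of_nat (n + 1) * \<rho> j ^ (n + 1)) \<longlonglongrightarrow> 0" if "0 < j" "j < k" for j
    using LIMSEQ_Suc[OF powser_times_n_limit_0[OF \<rho>1[OF that]]] by simp
  have lim1: "(\<lambda>n. \<rho> j ^ (n + 1)) \<longlonglongrightarrow> 0" if "0 < j" "j < k" for j
    using LIMSEQ_Suc[OF LIMSEQ_power_zero[OF \<rho>1[OF that]]] by simp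
  have split: "{..<k} = insert 0 {0<..<k}" using k by auto
  have "T1 = (\<lambda>n. 1 + (\<Sum>j\<in>{0<..<k}. zeta k j powi (- int r) * \<rho> j ^ (n + 1)))"
    unfolding T1_def split by (simp add: \<rho>0) (simp add: zeta_def)
  moreover have "(\<lambda>n. 1 + (\<Sum>j\<in>{0<..<k}. zeta k j powi (- int r) * \<rho> j ^ (n + 1))) \<longlonglongrightarrow>
      1 + (\<Sum>j\<in>{0<..<k}. zeta k j powi (- int r) * 0)"
    by (intro tendsto_intros lim1) auto
  ultimately have T1: "T1 \<longlonglongrightarrow> 1" by simp
  \<comment> \<open>The two terms for \<open>j = 0\<close> are both 1 and cancel, leaving only
    decaying terms.\<close>
  have "of_nat (n + 1) * (T2 n - T1 n) = (\<Sum>j\<in>{0<..<k}. (zeta k j powi (- int r + 1) * \<rho> j - zeta k j powi (- int r))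
      * (of_nat (n + 1) * \<rho> j ^ (n + 1)))" for n
  proof -
    have "T2 n - T1 n = (\<Sum>j\<in>{0<..<k}. zeta k j powi (- int r + 1) * \<rho> j ^ (n + 2) - zeta k j powi (- int r) * \<rho> j ^ (n + 1))"
      unfolding T1_def T2_def split sum_subtractf[symmetric] by (simp add: \<rho>0) (simp add: zeta_def)
    then show ?thesis
      by (simp add: sum_distrib_left algebra_simps)
  qed
  moreover have "(\<lambda>n. \<Sum>j\<in>{0<..<k}. (zeta k j powi (- int r + 1) * \<rho> j - zeta k j powi (- int r))
      * (of_nat (n + 1) * \<rho> j ^ (n + 1))) \<longlonglongrightarrow>
      (\<Sum>j\<in>{0<..<k}. (zeta k j powi (- int r + 1) * \<rho> j - zeta k j powi (- int r)) * 0)"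
    by (intro tendsto_intros lim0) auto
  ultimately have D: "(\<lambda>n. of_nat (n + 1) * (T2 n - T1 n)) \<longlonglongrightarrow> 0" by simp
  \<comment> \<open>This sequence is exactly the deviation of the frequency from its asymptotic
    line, as the algebra that follows confirms.\<close>
  have "(\<lambda>n. \<phi> / (of_nat k * c) * (of_nat (n + 1) * (T2 n - T1 n)) / T1 n) \<longlonglongrightarrow>
      \<phi> / (of_nat k * c) * 0 / 1"
    by (intro tendsto_intros D T1) auto
  moreover have "complex_of_real (freq k \<epsilon> r n - (F k \<epsilon> / (real k * (1 - F k \<epsilon>)) * real n
      + F k \<epsilon> / (real k * (1 - F k \<epsilon>)) - real r / real k))
    = \<phi> / (of_nat k * c) * (of_nat (n + 1) * (T2 n - T1 n)) / T1 n" for n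
  proof -
    have "complex_of_real (freq k \<epsilon> r n) = (- of_nat r * (T1 n / c ^ (n + 1)) + \<phi> * (of_nat n + 1) * (T2 n / c ^ (n + 2)))
        / (of_nat k * (T1 n / c ^ (n + 1)))"
      unfolding freq_closed_form(1)[OF assms] S1 S2 \<phi>_def ..
    also have "\<dots> = - of_nat r / of_nat k + \<phi> * (of_nat n + 1) * T2 n / (of_nat k * c * T1 n)"
    proof -
      have gen: "(- r * (t / d) + p * (u / (c * d))) / (k * (t / d)) = - r / k + p * u / (k * c * t)"
        if "d \<noteq> 0" "t \<noteq> 0" "k \<noteq> 0" for r t d p u k :: complex
        using that c0 by (simp add: field_simps)
      show ?thesis
        using gen[of "c ^ (n + 1)" "T1 n" "of_nat k" "of_nat r"] c0 T10[of n] k by simp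
    qed
    finally have *: "complex_of_real (freq k \<epsilon> r n) = \<dots>" .
    have gen: "(- r / k + p * (m + 1) * u / (k * c * t)) - (p / (k * c) * m + p / (k * c) - r / k)
        = p / (k * c) * ((m + 1) * (u - t)) / t" if "t \<noteq> 0" "k \<noteq> 0" for r t p u k m :: complex
      using that c0 by (simp add: field_simps)
    have "complex_of_real (freq k \<epsilon> r n - (F k \<epsilon> / (real k * (1 - F k \<epsilon>)) * real n
      + F k \<epsilon> / (real k * (1 - F k \<epsilon>)) - real r / real k))
      = of_real (freq k \<epsilon> r n) - (\<phi> / (of_nat k * c) * of_nat n + \<phi> / (of_nat k * c) - of_nat r / of_nat k)"
      by (simp add: \<phi>_def c_def)
    then show ?thesis
      using * gen[of "T1 n" "of_nat k" "of_nat r" \<phi> "of_nat n" "T2 n"] T10[of n] k by (simp add: add.commute)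
  qed
  ultimately have "(\<lambda>n. complex_of_real (freq k \<epsilon> r n - (F k \<epsilon> / (real k * (1 - F k \<epsilon>)) * real n
      + F k \<epsilon> / (real k * (1 - F k \<epsilon>)) - real r / real k))) \<longlonglongrightarrow> of_real 0"
    by simp
  then show ?thesis by (simp only: tendsto_of_real_iff)
qed

section \<open>Projections and diagonal flows on the Drury--Arveson space\<close>

instance drury_arveson :: banach ..

section \<open>Orthogonal complements and projections\<close>

lemma da_cinner_add_right: "da_cinner h (f + g) = da_cinner h f + da_cinner h g"
  by (subst (1 2 3) da_cinner_commute) (simp add: da_cinner_add_left)

lemma da_cinner_scale_right: "da_cinner f (a *\<^sub>C g) = cnj a * da_cinner f g"
  by (subst (1 2) da_cinner_commute) (simp add: da_cinner_scale_left)

lemma da_cinner_0_right [simp]: "da_cinner f 0 = 0"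
  using da_cinner_scale_right[of f 0 0] by simp

text \<open>The complex product is recovered from the real one, so closedness and orthogonality can
  be obtained from facts about real inner product spaces.\<close>

lemma da_cinner_eq_inner: "da_cinner f g = Complex (inner f g) (inner f (\<i> *\<^sub>C g))"
  by (simp add: complex_eq_iff inner_drury_arveson_def da_cinner_scale_right)

lemma da_cinner_self_norm: "da_cinner f f = of_real ((norm f)\<^sup>2)"
  by (simp only: da_cinner_self da_norm_sq)

lemma da_minus_scale: "f - g = f + (-1) *\<^sub>C g" for f g :: drury_arveson
  by (simp only: minus_drury_arveson_def uminus_drury_arveson_def)

lemma da_orth_0: "0 \<in> da_orth A"
  unfolding da_orth_def using da_cinner_scale_left[of 0 0] by simp

lemma da_orth_add: "f \<in> da_orth A \<Longrightarrow> g \<in> da_orth A \<Longrightarrow> f + g \<in> da_orth A"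
  by (simp add: da_orth_def da_cinner_add_left)

lemma da_orth_scale: "f \<in> da_orth A \<Longrightarrow> a *\<^sub>C f \<in> da_orth A"
  by (simp add: da_orth_def da_cinner_scale_left)

lemma da_orth_diff: "f \<in> da_orth A \<Longrightarrow> g \<in> da_orth A \<Longrightarrow> f - g \<in> da_orth A"
  unfolding da_minus_scale by (intro da_orth_add da_orth_scale)

lemma DA_subspace_da_orth: "DA.subspace (da_orth A)"
  by (intro DA.subspaceI da_orth_0 da_orth_add da_orth_scale)

lemma subspace_da_orth: "subspace (da_orth A)"
  unfolding subspace_def scaleR_drury_arveson_def
  by (intro conjI ballI allI impI da_orth_0 da_orth_add da_orth_scale)

lemma closed_da_orth: "closed (da_orth A)"
proof -
  have "da_orth A = (\<Inter>g\<in>A. {f. inner f g = 0} \<inter> {f. inner f (\<i> *\<^sub>C g) = 0})"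
    by (auto simp: da_orth_def da_cinner_eq_inner complex_eq_iff)
  moreover have "closed {f. inner f g = 0}" for g :: drury_arveson
    by (intro closed_Collect_eq continuous_intros)
  ultimately show ?thesis by (simp only:) (intro closed_INT ballI closed_Int)
qed

text \<open>A minimising sequence for the distance to \<open>V\<close> is Cauchy by the
  parallelogram law, and its limit is a nearest point. Minimality along every line through that
  point gives orthogonality.\<close>

lemma projection_exists:
  fixes V :: "'a::{real_inner,complete_space} set"
  assumes "closed V" "subspace V"
  obtains g where "g \<in> V" "\<And>h. h \<in> V \<Longrightarrow> inner (f - g) h = 0"
proof -
  have ne: "V \<noteq> {}" using assms(2) subspace_0 by auto
  define d where "d = infdist f V"
  have d0: "d \<ge> 0" by (simp add: d_def infdist_nonneg)
  have dle: "d \<le> norm (f - h)" if "h \<in> V" for h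
    using infdist_le[OF that, of f] by (simp add: d_def dist_norm)
  have "\<exists>x\<in>V. norm (f - x) < d + 1 / real (Suc n)" for n
  proof -
    have "d < d + 1 / real (Suc n)" by simp
    then have "(INF a\<in>V. dist f a) < d + 1 / real (Suc n)"
      by (simp only: d_def infdist_notempty[OF ne])
    then show ?thesis
      using ne by (subst (asm) cINF_less_iff) (auto simp: dist_norm intro!: bdd_belowI2[of _ 0])
  qed
  then obtain x where xV: "\<And>n. x n \<in> V" and x: "\<And>n. norm (f - x n) < d + 1 / real (Suc n)"
    by metis
  \<comment> \<open>The parallelogram law; the midpoint \<open>c\<close> lies in \<open>V\<close>,
    so its distance from \<open>f\<close> is at least \<open>d\<close>.\<close>
  have par: "(norm (x m - x n))\<^sup>2 \<le> 2 * (norm (f - x m))\<^sup>2 + 2 * (norm (f - x n))\<^sup>2 - 4 * d\<^sup>2" for m n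
  proof -
    define c where "c = (1 / 2) *\<^sub>R (x m + x n)"
    have "c \<in> V" unfolding c_def using assms(2) xV by (intro subspace_scale subspace_add)
    then have "d\<^sup>2 \<le> (norm (f - c))\<^sup>2" using dle d0 by (intro power_mono)
    moreover have "(norm (x m - x n))\<^sup>2 = 2 * (norm (f - x m))\<^sup>2 + 2 * (norm (f - x n))\<^sup>2 - 4 * (norm (f - c))\<^sup>2"
      unfolding power2_norm_eq_inner c_def
      by (simp add: inner_diff_left inner_diff_right inner_add_left inner_add_right inner_commute field_simps)
    ultimately show ?thesis by linarith
  qed
  have "Cauchy x"
  proof (rule metric_CauchyI)
    fix e :: real assume e: "e > 0"
    \<comment> \<open>Chosen so that \<open>\<eta> * (8 * d + 4)\<close>, the bound obtained below
      for the squared distance of two late terms, is less than the square of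
      \<open>e\<close>.\<close>
    obtain N where N: "(8 * d + 4) / e\<^sup>2 < real N"
      using reals_Archimedean2 by blast
    define \<eta> where "\<eta> = 1 / real (Suc N)"
    have \<eta>: "0 < \<eta>" "\<eta> \<le> 1" by (auto simp: \<eta>_def)
    have le: "(norm (f - x n))\<^sup>2 \<le> (d + \<eta>)\<^sup>2" if "n \<ge> N" for n
    proof (rule power_mono)
      have "1 / real (Suc n) \<le> \<eta>" unfolding \<eta>_def using that by (intro divide_left_mono) auto
      then show "norm (f - x n) \<le> d + \<eta>" using x[of n] by linarith
    qed simp
    have "dist (x m) (x n) < e" if "m \<ge> N" "n \<ge> N" for m n
    proof (rule power2_less_imp_less)
      have "(dist (x m) (x n))\<^sup>2 \<le> 4 * (d + \<eta>)\<^sup>2 - 4 * d\<^sup>2"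
        using par[of m n] le[OF that(1)] le[OF that(2)] by (simp add: dist_norm)
      also have "\<dots> = \<eta> * (8 * d + 4 * \<eta>)" by (simp add: power2_eq_square algebra_simps)
      also have "\<dots> \<le> \<eta> * (8 * d + 4)" using \<eta> by (intro mult_left_mono) auto
      also have "\<dots> < e\<^sup>2"
      proof -
        have "8 * d + 4 < real N * e\<^sup>2" using N e by (simp add: divide_less_eq)
        also have "\<dots> \<le> real (Suc N) * e\<^sup>2" by (intro mult_right_mono) auto
        finally show ?thesis by (simp add: \<eta>_def divide_less_eq mult.commute del: of_nat_Suc)
      qed
      finally show "(dist (x m) (x n))\<^sup>2 < e\<^sup>2" .
    qed (use e in auto)
    then show "\<exists>M. \<forall>m\<ge>M. \<forall>n\<ge>M. dist (x m) (x n) < e" by blast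
  qed
  then obtain g where g: "x \<longlonglongrightarrow> g" by (meson Cauchy_convergent convergent_def)
  have gV: "g \<in> V" using assms(1) xV g closed_sequentially by blast
  have ng: "norm (f - g) \<le> d"
  proof (rule LIMSEQ_le)
    show "(\<lambda>n. norm (f - x n)) \<longlonglongrightarrow> norm (f - g)" by (intro tendsto_intros g)
    show "(\<lambda>n. d + 1 / real (Suc n)) \<longlonglongrightarrow> d"
      using tendsto_add[OF tendsto_const[of d] LIMSEQ_Suc[OF lim_1_over_n]] by simp
    show "\<exists>N. \<forall>n\<ge>N. norm (f - x n) \<le> d + 1 / real (Suc n)"
      using x less_imp_le by blast
  qed
  show ?thesis
  proof (rule that[OF gV])
    fix h assume h: "h \<in> V"
    show "inner (f - g) h = 0"
    proof (cases "h = 0")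
      case False
      \<comment> \<open>The step length that minimises the distance from \<open>f\<close> to the
        line through \<open>g\<close> in direction \<open>h\<close>.\<close>
      define s where "s = inner (f - g) h / (norm h)\<^sup>2"
      have "g + s *\<^sub>R h \<in> V" using gV h assms(2) by (intro subspace_add subspace_scale)
      then have "norm (f - g) \<le> norm (f - (g + s *\<^sub>R h))" using dle ng by (meson order_trans)
      then have "(norm (f - g))\<^sup>2 \<le> (norm ((f - g) - s *\<^sub>R h))\<^sup>2"
        by (intro power_mono) (auto simp: algebra_simps)
      also have "\<dots> = (norm (f - g))\<^sup>2 - 2 * s * inner (f - g) h + s\<^sup>2 * (norm h)\<^sup>2"
        unfolding power2_norm_eq_inner
        by (simp add: inner_diff_left[of _ "s *\<^sub>R h"] inner_diff_right[of _ _ "s *\<^sub>R h"] inner_commute power2_eq_square algebra_simps)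
      also have "\<dots> = (norm (f - g))\<^sup>2 - (inner (f - g) h)\<^sup>2 / (norm h)\<^sup>2"
        using False by (simp add: s_def power2_eq_square field_simps)
      finally have "(inner (f - g) h)\<^sup>2 / (norm h)\<^sup>2 \<le> 0" by simp
      then show ?thesis using False by (simp add: divide_le_0_iff)
    qed simp
  qed
qed

text \<open>Uniqueness behind the \<open>THE\<close>: the difference of two candidates lies in the
  complement and is also orthogonal to it, hence is orthogonal to itself.\<close>

lemma da_proj_eqI:
  assumes "g \<in> da_orth A" and "f - g \<in> da_orth (da_orth A)"
  shows "da_proj (da_orth A) f = g"
  unfolding da_proj_def
proof (rule the_equality)
  fix h assume h: "h \<in> da_orth A \<and> f - h \<in> da_orth (da_orth A)"
  have "h - g = (f - g) - (f - h)" by simp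
  also have "\<dots> \<in> da_orth (da_orth A)"
    by (rule da_orth_diff[OF assms(2) conjunct2[OF h]])
  finally have "da_cinner (h - g) (h - g) = 0"
    using da_orth_diff[of h A g] assms h by (simp add: da_orth_def)
  then show "h = g" by (simp add: da_cinner_self_norm)
qed (use assms in blast)

text \<open>This translates vanishing of the connection into orthogonality of the derivative to the
  fibre. The forward direction rests on existence of the projection, without which the value of
  \<open>da_proj\<close> would say nothing about \<open>f\<close>.\<close>

lemma da_proj_eq_0_iff: "da_proj (da_orth A) f = 0 \<longleftrightarrow> f \<in> da_orth (da_orth A)"
proof
  assume 0: "da_proj (da_orth A) f = 0"
  obtain g where g: "g \<in> da_orth A" "\<And>h. h \<in> da_orth A \<Longrightarrow> inner (f - g) h = 0"
    using projection_exists[OF closed_da_orth subspace_da_orth] by metis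
  have "f - g \<in> da_orth (da_orth A)"
    unfolding da_orth_def[of "da_orth A"] using g(2) da_orth_scale by (auto simp: da_cinner_eq_inner complex_eq_iff)
  with da_proj_eqI[OF g(1)] 0 show "f \<in> da_orth (da_orth A)" by auto
qed (auto intro: da_proj_eqI da_orth_0)

section \<open>Elements given by their coefficients\<close>

definition da_l2 :: "(nat \<times> nat \<Rightarrow> complex) \<Rightarrow> bool" where
  "da_l2 c \<longleftrightarrow> (\<lambda>p. da_weight (fst p) (snd p) * (cmod (c p))\<^sup>2) summable_on UNIV"

lemma da_l2_coeff [simp]: "da_l2 (da_coeff f)"
  using da_coeff_sq_summable[of f] by (simp add: da_l2_def case_prod_unfold)

lemma da_l2_mono:
  assumes "da_l2 d" "\<And>p. cmod (c p) \<le> cmod (d p)"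
  shows "da_l2 c"
  unfolding da_l2_def
  by (rule summable_on_comparison_test[OF assms(1)[unfolded da_l2_def]])
    (auto intro!: mult_left_mono power_mono assms(2))

lemma da_norm_sq': "(norm f)\<^sup>2 = (\<Sum>\<^sub>\<infinity>p. da_weight (fst p) (snd p) * (cmod (da_coeff f p))\<^sup>2)"
  unfolding da_norm_sq by (simp add: case_prod_unfold)

lemma da_cinner_eq: "da_cinner f g = (\<Sum>\<^sub>\<infinity>p. da_weight (fst p) (snd p) * (da_coeff f p * cnj (da_coeff g p)))"
  unfolding da_cinner_def by (simp add: case_prod_unfold mult.assoc)

lemma da_norm_mono:
  assumes "\<And>p. cmod (da_coeff f p) \<le> cmod (da_coeff g p)"
  shows "norm f \<le> norm g"
proof (rule power2_le_imp_le)
  show "(norm f)\<^sup>2 \<le> (norm g)\<^sup>2"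
    unfolding da_norm_sq' using da_l2_coeff[unfolded da_l2_def]
    by (intro infsum_mono mult_left_mono power_mono assms) auto
qed simp

lemma da_coeff_bound: "da_weight (fst p) (snd p) * (cmod (da_coeff f p))\<^sup>2 \<le> (norm f)\<^sup>2"
proof -
  have "(\<Sum>p\<in>{p}. da_weight (fst p) (snd p) * (cmod (da_coeff f p))\<^sup>2) \<le> (norm f)\<^sup>2"
    unfolding da_norm_sq' using da_l2_coeff[unfolded da_l2_def]
    by (intro finite_sum_le_infsum) auto
  then show ?thesis by simp
qed

text \<open>Allows series converging in norm to be evaluated coefficient by coefficient.\<close>

lemma bounded_linear_da_coeff: "bounded_linear (\<lambda>f. da_coeff f p)"
proof (rule bounded_linear_intro)
  fix f :: drury_arveson
  define w where "w = sqrt (da_weight (fst p) (snd p))"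
  have w: "w > 0" by (simp add: w_def)
  have "w * cmod (da_coeff f p) \<le> norm f"
  proof (rule power2_le_imp_le)
    show "(w * cmod (da_coeff f p))\<^sup>2 \<le> (norm f)\<^sup>2"
      using da_coeff_bound[of p f] by (simp add: w_def power_mult_distrib)
  qed simp
  with w show "norm (da_coeff f p) \<le> norm f * (1 / w)"
    by (simp add: field_simps)
qed (simp_all add: da_coeff_add da_coeff_scaleR scaleR_conv_of_real)

definition da_of_coeff :: "(nat \<times> nat \<Rightarrow> complex) \<Rightarrow> drury_arveson" where
  "da_of_coeff c = (SOME f. da_coeff f = c)"

lemma da_coeff_of_coeff: "da_l2 c \<Longrightarrow> da_coeff (da_of_coeff c) = c"
  unfolding da_of_coeff_def
  by (rule someI_ex) (metis (mono_tags, lifting) da_coeff_surj da_l2_def case_prod_unfold summable_on_cong prod.collapse)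

section \<open>Diagonal unitary groups and their generators\<close>

text \<open>The unitary group for which each monomial is an eigenvector. As \<open>\<mu>\<close> may
  be unbounded, orbits are continuous but in general not differentiable.\<close>

definition da_rot :: "(nat \<times> nat \<Rightarrow> real) \<Rightarrow> real \<Rightarrow> drury_arveson \<Rightarrow> drury_arveson" where
  "da_rot \<mu> t f = da_of_coeff (\<lambda>p. cis (\<mu> p * t) * da_coeff f p)"

lemma da_coeff_rot: "da_coeff (da_rot \<mu> t f) = (\<lambda>p. cis (\<mu> p * t) * da_coeff f p)"
  unfolding da_rot_def
  by (intro da_coeff_of_coeff da_l2_mono[OF da_l2_coeff[of f]]) (simp add: norm_mult)

lemma da_rot_add: "da_rot \<mu> t (f + g) = da_rot \<mu> t f + da_rot \<mu> t g"
  by (rule da_eqI) (simp add: da_coeff_rot da_coeff_add algebra_simps)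

lemma da_rot_scale: "da_rot \<mu> t (a *\<^sub>C f) = a *\<^sub>C da_rot \<mu> t f"
  by (rule da_eqI) (simp add: da_coeff_rot da_coeff_scale algebra_simps)

lemma da_rot_diff: "da_rot \<mu> t (f - g) = da_rot \<mu> t f - da_rot \<mu> t g"
  by (rule da_eqI) (simp add: da_coeff_rot da_coeff_diff algebra_simps)

lemma da_rot_rot: "da_rot \<mu> s (da_rot \<mu> t f) = da_rot \<mu> (s + t) f"
  by (rule da_eqI) (simp add: da_coeff_rot algebra_simps flip: cis_mult)

lemma da_rot_0 [simp]: "da_rot \<mu> 0 f = f"
  by (rule da_eqI) (simp add: da_coeff_rot)

lemma da_cinner_rot: "da_cinner (da_rot \<mu> t f) (da_rot \<mu> t g) = da_cinner f g"
proof -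
  have "cis (\<mu> p * t) * a * cnj (cis (\<mu> p * t) * b) = a * cnj b" for p a b
    using cis_mult[of "\<mu> p * t" "- (\<mu> p * t)"] by (simp add: cis_cnj algebra_simps)
  then show ?thesis by (simp only: da_cinner_eq da_coeff_rot)
qed

lemma norm_da_rot [simp]: "norm (da_rot \<mu> t f) = norm f"
  by (intro order.antisym da_norm_mono) (simp_all add: da_coeff_rot norm_mult)

lemma isCont_da_rot: "isCont (da_rot \<mu> t) f"
proof -
  have "dist (da_rot \<mu> t g) (da_rot \<mu> t f) = dist g f" for g
    by (simp add: dist_norm flip: da_rot_diff)
  then show ?thesis by (simp add: continuous_at_eps_delta) blast
qed

text \<open>The smooth vectors of the group: elements in the domain of every power of the
  generator.\<close>

definition da_rapid :: "(nat \<times> nat \<Rightarrow> real) \<Rightarrow> drury_arveson \<Rightarrow> bool" where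
  "da_rapid \<mu> f \<longleftrightarrow> (\<forall>j. da_l2 (\<lambda>p. of_real (\<mu> p ^ j) * da_coeff f p))"

text \<open>The generator of the group. It is applied only to rapid elements, where the new
  coefficients are again square summable.\<close>

definition da_gen :: "(nat \<times> nat \<Rightarrow> real) \<Rightarrow> drury_arveson \<Rightarrow> drury_arveson" where
  "da_gen \<mu> f = da_of_coeff (\<lambda>p. \<i> * of_real (\<mu> p) * da_coeff f p)"

lemma da_coeff_gen:
  assumes "da_rapid \<mu> f"
  shows "da_coeff (da_gen \<mu> f) = (\<lambda>p. \<i> * of_real (\<mu> p) * da_coeff f p)"
  unfolding da_gen_def
  by (intro da_coeff_of_coeff da_l2_mono[OF assms[unfolded da_rapid_def, rule_format, of 1]])
    (simp add: norm_mult)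

lemma da_rapid_gen: "da_rapid \<mu> f \<Longrightarrow> da_rapid \<mu> (da_gen \<mu> f)"
  unfolding da_rapid_def
proof
  fix j
  assume *: "\<forall>j. da_l2 (\<lambda>p. of_real (\<mu> p ^ j) * da_coeff f p)"
  then have c: "da_coeff (da_gen \<mu> f) = (\<lambda>p. \<i> * of_real (\<mu> p) * da_coeff f p)"
    by (intro da_coeff_gen) (simp add: da_rapid_def)
  show "da_l2 (\<lambda>p. of_real (\<mu> p ^ j) * da_coeff (da_gen \<mu> f) p)"
    unfolding c by (rule da_l2_mono[OF *[rule_format, of "Suc j"]]) (simp add: norm_mult mult_ac)
qed

lemma cis_linear_remainder: "cmod (cis x - 1 - \<i> * of_real x) \<le> x\<^sup>2"
  using Taylor_exp[of "\<i> * of_real x" 1] by (simp add: cis_conv_exp norm_mult power2_eq_square algebra_simps)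

text \<open>The second-order remainder of the exponential, applied to each coefficient with argument
  \<open>\<mu> p * (s - t)\<close>, bounds the error in norm by \<open>(s - t)^2\<close> times the
  norm of the twice-applied generator.\<close>

lemma da_rot_has_vector_derivative:
  assumes "da_rapid \<mu> f"
  shows "((\<lambda>t. da_rot \<mu> t f) has_vector_derivative da_rot \<mu> t (da_gen \<mu> f)) (at t)"
  unfolding has_vector_derivative_def
proof (rule has_derivativeI_sandwich[where e = 1])
  define K where "K = norm (da_gen \<mu> (da_gen \<mu> f))"
  show "bounded_linear (\<lambda>h. h *\<^sub>R da_rot \<mu> t (da_gen \<mu> f))"
    by (rule bounded_linear_scaleR_left)
  show "((\<lambda>s. \<bar>s - t\<bar> * K) \<longlongrightarrow> 0) (at t)"
    by (auto intro!: tendsto_eq_intros)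
  fix s assume s: "s \<noteq> t"
  have "norm (da_rot \<mu> s f - da_rot \<mu> t f - (s - t) *\<^sub>R da_rot \<mu> t (da_gen \<mu> f))
    \<le> norm ((s - t)\<^sup>2 *\<^sub>R da_gen \<mu> (da_gen \<mu> f))"
  proof (rule da_norm_mono)
    fix p
    have "cis (\<mu> p * s) = cis (\<mu> p * t) * cis (\<mu> p * (s - t))"
      by (simp add: cis_mult algebra_simps)
    then have "da_coeff (da_rot \<mu> s f - da_rot \<mu> t f - (s - t) *\<^sub>R da_rot \<mu> t (da_gen \<mu> f)) p
      = cis (\<mu> p * t) * (cis (\<mu> p * (s - t)) - 1 - \<i> * of_real (\<mu> p * (s - t))) * da_coeff f p"
      by (simp add: da_coeff_diff da_coeff_scaleR da_coeff_rot da_coeff_gen[OF assms]) (simp add: algebra_simps)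
    then have "cmod (da_coeff (da_rot \<mu> s f - da_rot \<mu> t f - (s - t) *\<^sub>R da_rot \<mu> t (da_gen \<mu> f)) p)
      \<le> (\<mu> p * (s - t))\<^sup>2 * cmod (da_coeff f p)"
      using cis_linear_remainder[of "\<mu> p * (s - t)"] by (simp only: norm_mult norm_cis mult_1 mult_right_mono norm_ge_zero)
    also have "\<dots> = cmod (da_coeff ((s - t)\<^sup>2 *\<^sub>R da_gen \<mu> (da_gen \<mu> f)) p)"
      by (simp add: da_coeff_scaleR da_coeff_gen assms da_rapid_gen norm_mult power2_eq_square del: of_real_diff of_real_mult)
    finally show "cmod (da_coeff (da_rot \<mu> s f - da_rot \<mu> t f - (s - t) *\<^sub>R da_rot \<mu> t (da_gen \<mu> f)) p)
      \<le> cmod (da_coeff ((s - t)\<^sup>2 *\<^sub>R da_gen \<mu> (da_gen \<mu> f)) p)" .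
  qed
  then show "norm (da_rot \<mu> s f - da_rot \<mu> t f - (s - t) *\<^sub>R da_rot \<mu> t (da_gen \<mu> f)) / norm (s - t) \<le> \<bar>s - t\<bar> * K"
    using s by (simp add: K_def divide_le_eq power2_eq_square mult_ac abs_mult_self_eq flip: abs_mult)
qed simp

text \<open>The \<open>n\<close>-th derivative is the orbit of the \<open>n\<close>-fold generator
  applied to \<open>f\<close>, which is again rapid.\<close>

lemma smooth_curve_da_rot:
  assumes "da_rapid \<mu> f"
  shows "smooth_curve (\<lambda>t. da_rot \<mu> t f)"
  unfolding smooth_curve_def
proof (intro allI)
  fix n t
  have r: "da_rapid \<mu> ((da_gen \<mu> ^^ n) f)" for n
    by (induction n) (auto simp: assms da_rapid_gen)
  have "((\<lambda>\<eta> s. vector_derivative \<eta> (at s)) ^^ n) (\<lambda>t. da_rot \<mu> t f) = (\<lambda>t. da_rot \<mu> t ((da_gen \<mu> ^^ n) f))"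
    by (induction n) (auto intro!: vector_derivative_at da_rot_has_vector_derivative r)
  then show "((\<lambda>\<eta> s. vector_derivative \<eta> (at s)) ^^ n) (\<lambda>t. da_rot \<mu> t f) differentiable at t"
    using da_rot_has_vector_derivative[OF r] by (auto intro: differentiableI_vector)
qed

section \<open>The fibres\<close>

lemma da_weight_nonzero [simp]: "da_weight m n \<noteq> 0"
  using da_weight_pos[of m n] by linarith

lemma da_cinner_monom_right: "da_cinner f (da_monom m n) = of_real (da_weight m n) * da_coeff f (m, n)"
proof -
  have "da_cinner f (da_monom m n) = (\<Sum>\<^sub>\<infinity>p\<in>{(m, n)}. of_real (da_weight m n) * da_coeff f (m, n))"
    unfolding da_cinner_def da_coeff_of_poly
    by (rule infsum_cong_neutral) (auto simp: coeff_monom split: if_splits)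
  then show ?thesis by simp
qed

lemma da_of_poly_add: "da_of_poly (p + q) = da_of_poly p + da_of_poly q"
  by (rule da_eqI) (auto simp: da_coeff_of_poly da_coeff_add)

lemma da_of_poly_smult: "da_of_poly (smult [:a:] p) = a *\<^sub>C da_of_poly p"
  by (rule da_eqI) (auto simp: da_coeff_of_poly da_coeff_scale)

text \<open>Used twice in succession, once for each variable, since bivariate polynomials are nested
  univariate ones.\<close>

lemma poly_monom_induct:
  assumes "P 0" and "\<And>p q. P p \<Longrightarrow> P q \<Longrightarrow> P (p + q)" and "\<And>a n. P (monom a n)"
  shows "P p"
proof -
  have "P (\<Sum>i\<in>A. monom (coeff p i) i)" for A
    by (induction A rule: infinite_finite_induct) (auto intro: assms)
  from this[of "{..degree p}"] show ?thesis by (simp only: poly_as_sum_of_monoms)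
qed

lemma da_of_poly_generator_monom:
  "da_of_poly ([:monom 1 k - [:c:]:] * monom (monom 1 m) n) = da_monom (m + k) n - c *\<^sub>C da_monom m n"
proof -
  have "(monom 1 k - [:c:]) * monom 1 m = monom 1 (m + k) - smult c (monom 1 m)"
    by (simp add: left_diff_distrib mult_monom add.commute)
  then have "[:monom 1 k - [:c:]:] * monom (monom 1 m) n
      = monom (monom 1 (m + k) - smult c (monom 1 m)) n"
    by (simp add: smult_monom)
  then have h: "da_of_poly ([:monom 1 k - [:c:]:] * monom (monom 1 m) n)
      = da_of_poly (monom (monom 1 (m + k) - smult c (monom 1 m)) n)"
    by (rule arg_cong)
  show ?thesis
    unfolding h by (rule da_eqI) (auto simp: da_coeff_of_poly da_coeff_diff da_coeff_scale)
qed

lemma da_cinner_diff_right: "da_cinner h (f - g) = da_cinner h f - da_cinner h g"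
  unfolding da_minus_scale da_cinner_add_right da_cinner_scale_right by simp

text \<open>By linearity, orthogonality to the ideal need only be tested on the generator times
  monomials. The product is conjugate linear on the right, so \<open>cis t\<close> in the ideal
  becomes \<open>cis (- t)\<close> here.\<close>

lemma fibre_iff:
  "f \<in> fibre k \<epsilon> t \<longleftrightarrow> (\<forall>m n. of_real (da_weight (m + k) n) * da_coeff f (m + k, n)
    = of_real \<epsilon> * cis (- t) * (of_real (da_weight m n) * da_coeff f (m, n)))"
proof -
  define c where "c = of_real \<epsilon> * cis t"
  define g where "g = [:monom 1 k - [:c:]:]"
  have mon: "da_cinner f (da_of_poly (g * monom (monom 1 m) n)) = 0 \<longleftrightarrow>
      of_real (da_weight (m + k) n) * da_coeff f (m + k, n)
    = of_real \<epsilon> * cis (- t) * (of_real (da_weight m n) * da_coeff f (m, n))" for m n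
    unfolding g_def da_of_poly_generator_monom
    by (simp add: da_cinner_diff_right da_cinner_scale_right da_cinner_monom_right c_def cis_cnj mult.assoc)
  have fib: "f \<in> fibre k \<epsilon> t \<longleftrightarrow> (\<forall>q. da_cinner f (da_of_poly (g * q)) = 0)"
    by (auto simp: fibre_def da_orth_def ideal_t_def g_def c_def)
  have "da_cinner f (da_of_poly (g * q)) = 0"
    if *: "\<And>m n. da_cinner f (da_of_poly (g * monom (monom 1 m) n)) = 0" for q
  proof (induction q rule: poly_monom_induct)
    case 1
    show ?case using da_of_poly_smult[of 0 0] by simp
  next
    case (2 p q)
    then show ?case by (simp only: distrib_left da_of_poly_add da_cinner_add_right add_0)
  next
    case (3 u n)
    show ?case
    proof (induction u rule: poly_monom_induct)
      case 1
      show ?case using da_of_poly_smult[of 0 0] by simp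
    next
      case (2 p q)
      then show ?case
        by (simp only: add_monom[symmetric] distrib_left da_of_poly_add da_cinner_add_right add_0)
    next
      case (3 a m)
      have "monom (monom a m) n = smult [:a:] (monom (monom 1 m) n)"
        by (simp add: smult_monom)
      then show ?case
        by (simp only: mult_smult_right da_of_poly_smult da_cinner_scale_right * mult_zero_right)
    qed
  qed
  then show ?thesis unfolding fib mon[symmetric] by blast
qed

text \<open>Iterating the recursion shows that an element of the fibre is determined on each row by
  its entry with first index below \<open>k\<close>.\<close>

lemma fibre_coeff:
  assumes "f \<in> fibre k \<epsilon> t"
  shows "of_real (da_weight (r + k * q) n) * da_coeff f (r + k * q, n)
    = of_real (\<epsilon> ^ q) * cis (- (real q * t)) * (of_real (da_weight r n) * da_coeff f (r, n))"
proof (induction q)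
  case (Suc q)
  have "of_real (da_weight (r + k * Suc q) n) * da_coeff f (r + k * Suc q, n)
      = of_real \<epsilon> * cis (- t) * (of_real (da_weight (r + k * q) n) * da_coeff f (r + k * q, n))"
    using assms[unfolded fibre_iff, rule_format, of "r + k * q" n] by (simp add: add.assoc add.commute[of k])
  also have "\<dots> = of_real (\<epsilon> ^ Suc q) * (cis (- t) * cis (- (real q * t))) * (of_real (da_weight r n) * da_coeff f (r, n))"
    unfolding Suc.IH by simp
  also have "cis (- t) * cis (- (real q * t)) = cis (- (real (Suc q) * t))"
    by (simp add: cis_mult algebra_simps)
  finally show ?case .
qed simp

text \<open>The rate drops by one when \<open>m\<close> grows by \<open>k\<close>, which is why \<open>da_rot (rate k \<epsilon>)\<close>
  carries fibres to fibres.\<close>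

definition rate :: "nat \<Rightarrow> real \<Rightarrow> nat \<times> nat \<Rightarrow> real" where
  "rate k \<epsilon> p = freq k \<epsilon> (fst p mod k) (snd p) - real (fst p div k)"

lemma da_rot_fibre:
  assumes "k \<ge> 1" "f \<in> fibre k \<epsilon> t"
  shows "da_rot (rate k \<epsilon>) s f \<in> fibre k \<epsilon> (t + s)"
  unfolding fibre_iff
proof (intro allI)
  fix m n
  have rate: "rate k \<epsilon> (m + k, n) = rate k \<epsilon> (m, n) - 1"
    using assms(1) by (simp add: rate_def)
  have phase: "cis (rate k \<epsilon> (m + k, n) * s) * (of_real \<epsilon> * cis (- t))
      = of_real \<epsilon> * cis (- (t + s)) * cis (rate k \<epsilon> (m, n) * s)"
    unfolding rate by (simp add: cis_mult algebra_simps)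
  have "of_real (da_weight (m + k) n) * da_coeff (da_rot (rate k \<epsilon>) s f) (m + k, n)
      = cis (rate k \<epsilon> (m + k, n) * s) * (of_real (da_weight (m + k) n) * da_coeff f (m + k, n))"
    by (simp add: da_coeff_rot)
  also have "\<dots> = (cis (rate k \<epsilon> (m + k, n) * s) * (of_real \<epsilon> * cis (- t))) * (of_real (da_weight m n) * da_coeff f (m, n))"
    using assms(2)[unfolded fibre_iff, rule_format, of m n] by simp
  also have "\<dots> = of_real \<epsilon> * cis (- (t + s)) * (of_real (da_weight m n) * da_coeff (da_rot (rate k \<epsilon>) s f) (m, n))"
    unfolding phase by (simp add: da_coeff_rot)
  finally show "of_real (da_weight (m + k) n) * da_coeff (da_rot (rate k \<epsilon>) s f) (m + k, n)
      = of_real \<epsilon> * cis (- (t + s)) * (of_real (da_weight m n) * da_coeff (da_rot (rate k \<epsilon>) s f) (m, n))" .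
qed

section \<open>Coefficients and rapid decay of the frame vectors\<close>

lemma da_weight_le_1: "da_weight m n \<le> 1"
proof -
  have "(m + n) choose m \<ge> 1" by (simp add: Suc_le_eq)
  then have "real ((m + n) choose m) \<ge> real 1" by (rule of_nat_mono)
  then show ?thesis by (simp add: da_weight_def)
qed

lemma norm_da_monom: "norm (da_monom m n) = sqrt (da_weight m n)"
proof -
  have "complex_of_real ((norm (da_monom m n))\<^sup>2) = of_real (da_weight m n)"
    unfolding da_cinner_self_norm[symmetric] da_cinner_monom by simp
  then have "(norm (da_monom m n))\<^sup>2 = da_weight m n" by (simp only: of_real_eq_iff)
  then show ?thesis by (metis norm_ge_zero real_sqrt_unique)
qed

lemma norm_da_scale: "norm (a *\<^sub>C f) = cmod a * norm f"
proof -
  have "complex_of_real ((norm (a *\<^sub>C f))\<^sup>2) = of_real ((cmod a * norm f)\<^sup>2)"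
    unfolding da_cinner_self_norm[symmetric] da_cinner_scale_left da_cinner_scale_right
    by (simp add: da_cinner_self_norm power_mult_distrib complex_norm_square mult.assoc del: of_real_power)
  then have "(norm (a *\<^sub>C f))\<^sup>2 = (cmod a * norm f)\<^sup>2" by (simp only: of_real_eq_iff)
  then show ?thesis by (rule power2_eq_imp_eq) auto
qed

lemma frame_weight_summable:
  assumes "k \<ge> 1" "0 < \<epsilon>" "\<epsilon> < 1" "r < k"
  shows "summable (frame_weight k \<epsilon> r n)"
proof -
  have "frame_weight k \<epsilon> r n summable_on UNIV"
    by (rule frame_weight_has_sum[OF assms, of n]) (metis summable_on_def)
  then show ?thesis by (rule summable_on_imp_summable)
qed

text \<open>For fixed \<open>n\<close> the inverse weights and the powers of \<open>f - q\<close>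
  grow polynomially in \<open>q\<close>, against the geometric factor. Taken at the frequency and
  the even exponent \<open>2 * j\<close>, these are the sums deciding whether \<open>alpha\<close>
  is rapid.\<close>

lemma frame_weight_moment_summable:
  assumes k: "k \<ge> 1" and e: "0 < \<epsilon>" "\<epsilon> < 1"
  shows "summable (\<lambda>q. frame_weight k \<epsilon> r n q * (f - real q) ^ (2 * j))"
proof (rule summable_comparison_test')
  define K where "K = real (Suc n) ^ n * real (r + k + 1) ^ n * (\<bar>f\<bar> + 1) ^ (2 * j)"
  have "0 \<le> \<epsilon>\<^sup>2" "\<epsilon>\<^sup>2 < 1" using e by (auto simp: power_less_one_iff)
  then show "summable (\<lambda>q. K * (real (Suc q) ^ (n + 2 * j) * (\<epsilon>\<^sup>2) ^ q))"
    by (intro summable_mult summable_Suc_power_mult_power)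
  fix q
  have 1: "inverse (da_weight (r + k * q) n) \<le> real (Suc n) ^ n * real (r + k + 1) ^ n * real (Suc q) ^ n"
  proof -
    have "Suc (r + k * q) \<le> (r + k + 1) * Suc q" by (simp add: algebra_simps)
    then have "real (Suc (r + k * q)) \<le> real (r + k + 1) * real (Suc q)"
      by (metis of_nat_mono of_nat_mult)
    then have "real (Suc (r + k * q)) ^ n \<le> (real (r + k + 1) * real (Suc q)) ^ n"
      by (rule power_mono) simp
    then have "real (Suc n) ^ n * real (Suc (r + k * q)) ^ n \<le> real (Suc n) ^ n * (real (r + k + 1) ^ n * real (Suc q) ^ n)"
      by (simp only: power_mult_distrib mult_left_mono zero_le_power of_nat_0_le_iff)
    then show ?thesis
      using choose_le_Suc_power[of "r + k * q" n] by (simp only: inverse_da_weight mult.assoc)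
  qed
  have 2: "(f - real q) ^ (2 * j) \<le> (\<bar>f\<bar> + 1) ^ (2 * j) * real (Suc q) ^ (2 * j)"
  proof -
    have "\<bar>f - real q\<bar> \<le> (\<bar>f\<bar> + 1) * real (Suc q)" by (simp add: algebra_simps) (use mult_nonneg_nonneg[of "\<bar>f\<bar>" "real q"] in linarith)
    then have "\<bar>f - real q\<bar> ^ (2 * j) \<le> ((\<bar>f\<bar> + 1) * real (Suc q)) ^ (2 * j)"
      by (rule power_mono) simp
    then show ?thesis by (simp only: power_mult_distrib power_even_abs even_mult_iff even_numeral simp_thms)
  qed
  have "frame_weight k \<epsilon> r n q * (f - real q) ^ (2 * j)
    \<le> (real (Suc n) ^ n * real (r + k + 1) ^ n * real (Suc q) ^ n * \<epsilon> ^ (2 * q)) * ((\<bar>f\<bar> + 1) ^ (2 * j) * real (Suc q) ^ (2 * j))"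
    unfolding frame_weight_def using e by (intro mult_mono 1 2 order_refl) auto
  also have "\<dots> = K * (real (Suc q) ^ (n + 2 * j) * (\<epsilon>\<^sup>2) ^ q)"
    unfolding K_def power_mult power_add by (simp only: mult_ac)
  finally show "norm (frame_weight k \<epsilon> r n q * (f - real q) ^ (2 * j)) \<le> K * (real (Suc q) ^ (n + 2 * j) * (\<epsilon>\<^sup>2) ^ q)"
    using e by (simp add: frame_weight_def abs_mult)
qed

text \<open>The coefficients of \<open>alpha\<close>, with \<open>q\<close> read off as the quotient
  of the first exponent by \<open>k\<close>.\<close>

definition frame_coeff :: "nat \<Rightarrow> real \<Rightarrow> nat \<Rightarrow> nat \<Rightarrow> real \<Rightarrow> nat \<times> nat \<Rightarrow> complex" where
  "frame_coeff k \<epsilon> r n t p = (if fst p mod k = r \<and> snd p = n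
    then of_real (inverse (da_weight (fst p) (snd p)) * \<epsilon> ^ (fst p div k)) * cis (- (real (fst p div k) * t)) else 0)"

lemma da_coeff_alpha:
  assumes k: "k \<ge> 1" and e: "0 < \<epsilon>" "\<epsilon> < 1" and r: "r < k"
  shows "da_coeff (alpha k \<epsilon> r n t) = frame_coeff k \<epsilon> r n t"
proof
  fix p :: "nat \<times> nat"
  define g where "g q = of_real (inverse (da_weight (r + k * q) n) * \<epsilon> ^ q) * cis (- (real q * t))" for q
  have "summable (\<lambda>q. norm (g q *\<^sub>C da_monom (r + k * q) n))"
  proof (rule summable_comparison_test')
    \<comment> \<open>The norm of the \<open>q\<close>-th term carries the single power
      \<open>\<epsilon> ^ q\<close>, whereas \<open>frame_weight\<close> has exponent
      \<open>2 * q\<close>; hence the square root.\<close>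
    show "summable (frame_weight k (sqrt \<epsilon>) r n)"
      using assms by (intro frame_weight_summable) auto
    fix q
    have "sqrt (da_weight (r + k * q) n) \<le> 1" using da_weight_le_1 by simp
    then show "norm (norm (g q *\<^sub>C da_monom (r + k * q) n)) \<le> frame_weight k (sqrt \<epsilon>) r n q"
      using e by (simp add: norm_da_scale norm_da_monom g_def norm_mult frame_weight_def power_mult mult_left_le norm_inverse norm_power)
  qed
  then have "((\<lambda>q. g q *\<^sub>C da_monom (r + k * q) n) has_sum alpha k \<epsilon> r n t) UNIV"
    unfolding alpha_def g_def[symmetric] by (intro has_sum_infsum norm_summable_imp_summable_on)
  then have "((\<lambda>q. da_coeff (g q *\<^sub>C da_monom (r + k * q) n) p) has_sum da_coeff (alpha k \<epsilon> r n t) p) UNIV"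
    by (rule has_sum_bounded_linear[OF bounded_linear_da_coeff])
  moreover have "((\<lambda>q. da_coeff (g q *\<^sub>C da_monom (r + k * q) n) p) has_sum frame_coeff k \<epsilon> r n t p) UNIV"
  proof -
    \<comment> \<open>Only the term with \<open>q = fst p div k\<close> can contribute to the
      coefficient at \<open>p\<close>.\<close>
    have "((\<lambda>q. frame_coeff k \<epsilon> r n t p) has_sum frame_coeff k \<epsilon> r n t p) {fst p div k}"
      by (rule has_sum_finiteI) auto
    then show ?thesis
    proof (rule has_sum_cong_neutral[THEN iffD1, rotated -1])
      fix q assume q: "q \<in> UNIV - {fst p div k}"
      then have "r + k * q \<noteq> fst p" using r
        by (metis Diff_iff add.commute div_mult_self2 div_less gr_implies_not0 insertI1 add_0)
      then show "da_coeff (g q *\<^sub>C da_monom (r + k * q) n) p = 0"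
        by (auto simp: da_coeff_scale da_coeff_of_poly case_prod_unfold coeff_monom)
    next
      fix q assume "q \<in> {fst p div k} \<inter> UNIV"
      then have q: "q = fst p div k" by simp
      have "r + k * q = fst p \<longleftrightarrow> fst p mod k = r"
        using r q by (metis add.commute mod_less mod_mult_self2 mult_div_mod_eq)
      then show "frame_coeff k \<epsilon> r n t p = da_coeff (g q *\<^sub>C da_monom (r + k * q) n) p"
        by (auto simp: da_coeff_scale da_coeff_of_poly case_prod_unfold coeff_monom frame_coeff_def g_def q)
    qed auto
  qed
  ultimately show "da_coeff (alpha k \<epsilon> r n t) p = frame_coeff k \<epsilon> r n t p"
    by (rule has_sum_unique)
qed

lemma da_rapid_alpha:
  assumes k: "k \<ge> 1" and e: "0 < \<epsilon>" "\<epsilon> < 1" and r: "r < k"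
  shows "da_rapid (rate k \<epsilon>) (alpha k \<epsilon> r n t)"
  unfolding da_rapid_def
proof
  fix j
  define g where "g p = da_weight (fst p) (snd p) * (cmod (of_real (rate k \<epsilon> p ^ j) * da_coeff (alpha k \<epsilon> r n t) p))\<^sup>2" for p
  have g: "g (r + k * q, n) = frame_weight k \<epsilon> r n q * (freq k \<epsilon> r n - real q) ^ (2 * j)" for q
  proof -
    define w where "w = da_weight (r + k * q) n"
    have w: "w > 0" by (simp add: w_def)
    have rate: "rate k \<epsilon> (r + k * q, n) = freq k \<epsilon> r n - real q"
      using r by (simp add: rate_def)
    have "cmod (frame_coeff k \<epsilon> r n t (r + k * q, n)) = inverse w * \<epsilon> ^ q"
      using r e w by (simp add: frame_coeff_def norm_mult norm_power norm_inverse w_def)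
    then have "g (r + k * q, n) = w * (\<bar>freq k \<epsilon> r n - real q\<bar> ^ j * (inverse w * \<epsilon> ^ q))\<^sup>2"
      by (simp only: g_def da_coeff_alpha[OF assms] norm_mult norm_of_real power_abs rate fst_conv snd_conv w_def)
    also have "\<dots> = (w * inverse w) * inverse w * (\<epsilon> ^ q)\<^sup>2 * ((freq k \<epsilon> r n - real q) ^ j)\<^sup>2"
      by (simp add: power_mult_distrib flip: power_abs) (simp add: power2_eq_square mult_ac)
    also have "\<dots> = frame_weight k \<epsilon> r n q * (freq k \<epsilon> r n - real q) ^ (2 * j)"
      using w by (simp add: frame_weight_def w_def mult.commute flip: power_mult)
    finally show ?thesis .
  qed
  have "(\<lambda>q. g (r + k * q, n)) summable_on UNIV"
    unfolding g using e
    by (intro summable_nonneg_imp_summable_on frame_weight_moment_summable k e)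
      (auto simp: frame_weight_def intro!: mult_nonneg_nonneg)
  moreover have "inj (\<lambda>q. (r + k * q, n))" using k by (auto simp: inj_def)
  ultimately have "g summable_on range (\<lambda>q. (r + k * q, n))"
    by (subst summable_on_reindex) (auto simp: o_def)
  then have "g summable_on UNIV"
  proof (rule summable_on_cong_neutral[THEN iffD1, rotated -1])
    fix p assume p: "p \<in> UNIV - range (\<lambda>q. (r + k * q, n))"
    have "p = (fst p mod k + k * (fst p div k), snd p)" by simp
    with p have "\<not> (fst p mod k = r \<and> snd p = n)" by (metis DiffD2 rangeI)
    then have "da_coeff (alpha k \<epsilon> r n t) p = 0"
      unfolding da_coeff_alpha[OF assms] frame_coeff_def by (rule if_not_P)
    then show "g p = 0" by (simp add: g_def)
  qed auto
  then show "da_l2 (\<lambda>p. of_real (rate k \<epsilon> p ^ j) * da_coeff (alpha k \<epsilon> r n t) p)"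
    unfolding da_l2_def g_def .
qed

lemma da_rapid_scale: "da_rapid \<mu> f \<Longrightarrow> da_rapid \<mu> (a *\<^sub>C f)"
  unfolding da_rapid_def
proof
  fix j assume *: "\<forall>j. da_l2 (\<lambda>p. of_real (\<mu> p ^ j) * da_coeff f p)"
  have "(\<lambda>p. (cmod a)\<^sup>2 * (da_weight (fst p) (snd p) * (cmod (of_real (\<mu> p ^ j) * da_coeff f p))\<^sup>2)) summable_on UNIV"
    using * by (intro summable_on_cmult_right) (auto simp: da_l2_def)
  then show "da_l2 (\<lambda>p. of_real (\<mu> p ^ j) * da_coeff (a *\<^sub>C f) p)"
    by (simp add: da_l2_def da_coeff_scale norm_mult power_mult_distrib mult_ac)
qed

lemma da_rapid_add: "da_rapid \<mu> f \<Longrightarrow> da_rapid \<mu> g \<Longrightarrow> da_rapid \<mu> (f + g)"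
  unfolding da_rapid_def
proof
  fix j assume *: "\<forall>j. da_l2 (\<lambda>p. of_real (\<mu> p ^ j) * da_coeff f p)" "\<forall>j. da_l2 (\<lambda>p. of_real (\<mu> p ^ j) * da_coeff g p)"
  show "da_l2 (\<lambda>p. of_real (\<mu> p ^ j) * da_coeff (f + g) p)"
    using da_sq_add[of "\<lambda>p. of_real (\<mu> p ^ j) * da_coeff f p" "\<lambda>p. of_real (\<mu> p ^ j) * da_coeff g p"] *
    by (simp add: da_l2_def case_prod_unfold da_coeff_add distrib_left)
qed

lemma da_rapid_0: "da_rapid \<mu> 0"
  by (simp add: da_rapid_def da_l2_def da_coeff_0)

lemma da_rapid_sum: "(\<And>i. i \<in> A \<Longrightarrow> da_rapid \<mu> (f i)) \<Longrightarrow> da_rapid \<mu> (sum f A)"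
  by (induction A rule: infinite_finite_induct) (auto intro: da_rapid_add da_rapid_0)

lemma alpha_in_fibre:
  assumes k: "k \<ge> 1" and e: "0 < \<epsilon>" "\<epsilon> < 1" and r: "r < k"
  shows "alpha k \<epsilon> r n t \<in> fibre k \<epsilon> t"
  unfolding fibre_iff da_coeff_alpha[OF assms]
proof (intro allI)
  fix m n'
  have w: "of_real (da_weight a b) * (of_real (inverse (da_weight a b) * x) * z) = of_real x * z" for a b x and z :: complex
  proof -
    have "of_real (da_weight a b) * (of_real (inverse (da_weight a b) * x) * z)
        = of_real (da_weight a b * inverse (da_weight a b) * x) * z"
      by (simp only: of_real_mult mult.assoc)
    moreover have "da_weight a b * inverse (da_weight a b) = 1"
      using da_weight_pos[of a b] by (intro right_inverse) simp
    ultimately show ?thesis by (simp only: mult_1)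
  qed
  have c: "cis (- t) * cis (- (real q * t)) = cis (- (real (Suc q) * t))" for q
    by (simp add: cis_mult algebra_simps)
  show "of_real (da_weight (m + k) n') * frame_coeff k \<epsilon> r n t (m + k, n')
    = of_real \<epsilon> * cis (- t) * (of_real (da_weight m n') * frame_coeff k \<epsilon> r n t (m, n'))"
    using k c[of "m div k"] by (simp add: frame_coeff_def w mult.assoc del: of_real_mult of_nat_Suc) (simp add: mult_ac)
qed

section \<open>Flat sections\<close>

text \<open>The coefficient of \<open>alpha\<close> at \<open>(r + k * q, n)\<close> has phase
  \<open>cis (- q * t)\<close>, and the rate there is the frequency minus \<open>q\<close>.\<close>

lemma cis_scale_alpha_eq_rot:
  assumes "k \<ge> 1" "0 < \<epsilon>" "\<epsilon> < 1" "r < k"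
  shows "cis (freq k \<epsilon> r n * t) *\<^sub>C alpha k \<epsilon> r n t = da_rot (rate k \<epsilon>) t (alpha k \<epsilon> r n 0)"
proof (rule da_eqI, rule ext)
  fix p :: "nat \<times> nat"
  have "cis (freq k \<epsilon> r n * t) * cis (- (real q * t)) = cis ((freq k \<epsilon> r n - real q) * t)" for q
    by (simp add: cis_mult algebra_simps)
  then show "da_coeff (cis (freq k \<epsilon> r n * t) *\<^sub>C alpha k \<epsilon> r n t) p
      = da_coeff (da_rot (rate k \<epsilon>) t (alpha k \<epsilon> r n 0)) p"
    by (simp add: da_coeff_scale da_coeff_rot da_coeff_alpha[OF assms] frame_coeff_def rate_def mult.left_commute[of "cis _"])
qed

text \<open>The normalising factor of \<open>beta\<close> does not vary with time, so
  \<open>gamma\<close> is itself an orbit of the group.\<close>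

lemma norm_alpha:
  assumes "k \<ge> 1" "0 < \<epsilon>" "\<epsilon> < 1" "r < k"
  shows "norm (alpha k \<epsilon> r n t) = norm (alpha k \<epsilon> r n 0)"
  using arg_cong[OF cis_scale_alpha_eq_rot[OF assms, of n t], of norm] by (simp add: norm_da_scale)

lemma alpha_nonzero:
  assumes "k \<ge> 1" "0 < \<epsilon>" "\<epsilon> < 1" "r < k"
  shows "alpha k \<epsilon> r n t \<noteq> 0"
proof
  assume "alpha k \<epsilon> r n t = 0"
  then have "frame_coeff k \<epsilon> r n t (r, n) = 0"
    unfolding da_coeff_alpha[OF assms, symmetric] by (simp add: da_coeff_0)
  with assms(4) show False
    using da_weight_pos[of r n] by (simp add: frame_coeff_def)
qed

lemma gamma_eq_rot:
  assumes "k \<ge> 1" "0 < \<epsilon>" "\<epsilon> < 1" "r < k"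
  shows "gamma k \<epsilon> r n t = da_rot (rate k \<epsilon>) t (beta k \<epsilon> r n 0)"
  unfolding gamma_def beta_def norm_alpha[OF assms, of n t] scaleR_drury_arveson_def da_rot_scale
    cis_scale_alpha_eq_rot[OF assms, symmetric]
  by (rule DA.scale_left_commute)

lemma closed_fibre: "closed (fibre k \<epsilon> t)"
  unfolding fibre_def by (rule closed_da_orth)

lemma fibre_scale: "f \<in> fibre k \<epsilon> t \<Longrightarrow> a *\<^sub>C f \<in> fibre k \<epsilon> t"
  unfolding fibre_def by (rule da_orth_scale)

lemma beta_in_fibre:
  assumes "k \<ge> 1" "0 < \<epsilon>" "\<epsilon> < 1" "r < k"
  shows "beta k \<epsilon> r n t \<in> fibre k \<epsilon> t"
  unfolding beta_def scaleR_drury_arveson_def by (intro fibre_scale alpha_in_fibre assms)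

lemma da_rapid_beta:
  assumes "k \<ge> 1" "0 < \<epsilon>" "\<epsilon> < 1" "r < k"
  shows "da_rapid (rate k \<epsilon>) (beta k \<epsilon> r n t)"
  unfolding beta_def scaleR_drury_arveson_def by (intro da_rapid_scale da_rapid_alpha assms)

text \<open>Frame vectors with different indices have disjoint monomial supports.\<close>

lemma da_cinner_beta:
  assumes k: "k \<ge> 1" and e: "0 < \<epsilon>" "\<epsilon> < 1" and r: "r < k" "r' < k"
  shows "da_cinner (beta k \<epsilon> r n t) (beta k \<epsilon> r' n' t) = (if (r, n) = (r', n') then 1 else 0)"
proof (cases "(r, n) = (r', n')")
  case True
  have "norm (beta k \<epsilon> r n t) = 1"
    using alpha_nonzero[OF k e r(1), of n t] by (simp add: beta_def)
  then show ?thesis using True da_cinner_self_norm[of "beta k \<epsilon> r n t"] by simp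
next
  case False
  have "da_coeff (beta k \<epsilon> r n t) p * cnj (da_coeff (beta k \<epsilon> r' n' t) p) = 0" for p
    using False by (auto simp: beta_def da_coeff_scaleR da_coeff_alpha[OF k e r(1)] da_coeff_alpha[OF k e r(2)] frame_coeff_def)
  then have "da_cinner (beta k \<epsilon> r n t) (beta k \<epsilon> r' n' t) = 0"
    by (simp only: da_cinner_eq mult_zero_right infsum_0_simp)
  then show ?thesis using False by (simp only: if_False)
qed

section \<open>The generator maps rapid elements of the fibre into its complement\<close>

lemma bij_betw_row_decomposition:
  assumes "k \<ge> 1"
  shows "bij_betw (\<lambda>((r, n), q). (r + k * q, n)) (({..<k} \<times> UNIV) \<times> UNIV) (UNIV :: (nat \<times> nat) set)"
  by (rule bij_betw_byWitness[where f' = "\<lambda>p. ((fst p mod k, snd p), fst p div k)"])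
    (use assms in auto)

text \<open>The frequency is the mean of \<open>q\<close> with respect to the frame weights, so the weighted
  rates sum to zero along each row \<open>{(r + k q, n). q \<in> \<nat>}\<close>.\<close>

lemma da_cinner_gen_fibre:
  assumes k: "k \<ge> 1" and e: "0 < \<epsilon>" "\<epsilon> < 1"
    and f: "f \<in> fibre k \<epsilon> 0" "da_rapid (rate k \<epsilon>) f" and g: "g \<in> fibre k \<epsilon> 0"
  shows "da_cinner (da_gen (rate k \<epsilon>) f) g = 0"
proof -
  define h where "h p = of_real (da_weight (fst p) (snd p)) * (da_coeff (da_gen (rate k \<epsilon>) f) p * cnj (da_coeff g p))" for p
  have "(h has_sum da_cinner (da_gen (rate k \<epsilon>) f) g) UNIV"
    using has_sum_infsum[OF da_cinner_summable[of "da_gen (rate k \<epsilon>) f" g]]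
    by (simp add: da_cinner_def h_def[abs_def] case_prod_unfold mult.assoc)
  then have "((\<lambda>x. h ((\<lambda>((r, n), q). (r + k * q, n)) x)) has_sum da_cinner (da_gen (rate k \<epsilon>) f) g)
      (({..<k} \<times> UNIV) \<times> UNIV)"
    by (rule has_sum_reindex_bij_betw[OF bij_betw_row_decomposition[OF k], of h, THEN iffD2])
  then have "((\<lambda>_. 0) has_sum da_cinner (da_gen (rate k \<epsilon>) f) g) ({..<k} \<times> (UNIV :: nat set))"
  proof (rule has_sum_SigmaD)
    fix x :: "nat \<times> nat"
    assume x: "x \<in> {..<k} \<times> UNIV"
    define r n where "r = fst x" and "n = snd x"
    have r: "r < k" and xrn: "x = (r, n)" using x by (auto simp: r_def n_def)
    define u where "u = of_real (da_weight r n) * da_coeff f (r, n)"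
    define v where "v = of_real (da_weight r n) * da_coeff g (r, n)"
    \<comment> \<open>On one row \<open>f\<close> and \<open>g\<close> are multiples of the same
      sequence, so the summand is a constant times the frame weight times the rate.\<close>
    have row: "h (r + k * q, n) = \<i> * u * cnj v * of_real (freq k \<epsilon> r n * frame_weight k \<epsilon> r n q + (- 1) * (frame_weight k \<epsilon> r n q * real q))" for q
    proof -
      define w where "w = da_weight (r + k * q) n"
      have w: "w > 0" by (simp add: w_def)
      have c: "da_coeff f' (r + k * q, n) = of_real (inverse w * \<epsilon> ^ q) * (of_real (da_weight r n) * da_coeff f' (r, n))"
        if "f' \<in> fibre k \<epsilon> 0" for f'
      proof -
        have "of_real w * da_coeff f' (r + k * q, n) = of_real (\<epsilon> ^ q) * (of_real (da_weight r n) * da_coeff f' (r, n))"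
          using fibre_coeff[OF that, of r q n] by (simp add: w_def)
        then have "da_coeff f' (r + k * q, n) = (of_real (\<epsilon> ^ q) * (of_real (da_weight r n) * da_coeff f' (r, n))) / of_real w"
          using w by (simp add: eq_divide_eq mult.commute)
        then show ?thesis by (simp add: divide_inverse mult_ac)
      qed
      have rate: "rate k \<epsilon> (r + k * q, n) = freq k \<epsilon> r n - real q"
        using r by (simp add: rate_def)
      have "h (r + k * q, n) = of_real w * (\<i> * of_real (freq k \<epsilon> r n - real q) * (of_real (inverse w * \<epsilon> ^ q) * u)
          * cnj (of_real (inverse w * \<epsilon> ^ q) * v))"
        unfolding h_def da_coeff_gen[OF f(2)] c[OF f(1)] c[OF g] rate u_def v_def by (simp add: w_def)
      also have "\<dots> = \<i> * u * cnj v * of_real ((w * inverse w) * (freq k \<epsilon> r n - real q) * (inverse w * (\<epsilon> ^ q * \<epsilon> ^ q)))"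
        by simp
      also have "(w * inverse w) * (freq k \<epsilon> r n - real q) * (inverse w * (\<epsilon> ^ q * \<epsilon> ^ q))
          = freq k \<epsilon> r n * frame_weight k \<epsilon> r n q + (- 1) * (frame_weight k \<epsilon> r n q * real q)"
        using w by (simp add: frame_weight_def w_def algebra_simps flip: power_add mult_2)
      finally show ?thesis .
    qed
    have "((\<lambda>q. freq k \<epsilon> r n * frame_weight k \<epsilon> r n q + (- 1) * (frame_weight k \<epsilon> r n q * real q)) has_sum 0) UNIV"
    proof (rule frame_weight_has_sum[OF k e r, of n])
      fix A
      assume "(frame_weight k \<epsilon> r n has_sum A) UNIV"
        "((\<lambda>q. frame_weight k \<epsilon> r n q * real q) has_sum freq k \<epsilon> r n * A) UNIV"
      then have "((\<lambda>q. freq k \<epsilon> r n * frame_weight k \<epsilon> r n q + (- 1) * (frame_weight k \<epsilon> r n q * real q)) has_sum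
          (freq k \<epsilon> r n * A + (- 1) * (freq k \<epsilon> r n * A))) UNIV"
        by (intro has_sum_add has_sum_cmult_right)
      then show ?thesis by simp
    qed
    then have "((\<lambda>q. \<i> * u * cnj v * of_real (freq k \<epsilon> r n * frame_weight k \<epsilon> r n q + (- 1) * (frame_weight k \<epsilon> r n q * real q)))
        has_sum \<i> * u * cnj v * of_real 0) UNIV"
      by (intro has_sum_cmult_right has_sum_of_real)
    then show "((\<lambda>q. h ((\<lambda>((r, n), q). (r + k * q, n)) (x, q))) has_sum 0) UNIV"
      by (simp only: xrn prod.case row of_real_0 mult_zero_right)
  qed
  then show ?thesis using has_sum_unique[OF _ has_sum_0] by blast
qed

text \<open>The derivative of the orbit is the rotated generator. Rotating a test vector back by
  \<open>- t\<close> moves the orthogonality to the fibre over 0, where it is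
  \<open>da_cinner_gen_fibre\<close>.\<close>

lemma flat_da_rot:
  assumes k: "k \<ge> 1" and e: "0 < \<epsilon>" "\<epsilon> < 1"
    and f: "f \<in> fibre k \<epsilon> 0" "da_rapid (rate k \<epsilon>) f"
  shows "flat_section k \<epsilon> (\<lambda>t. da_rot (rate k \<epsilon>) t f)"
  unfolding flat_section_def smooth_sections_def
proof (intro conjI CollectI allI)
  show "smooth_curve (\<lambda>t. da_rot (rate k \<epsilon>) t f)"
    by (rule smooth_curve_da_rot[OF f(2)])
  fix t
  show "da_rot (rate k \<epsilon>) t f \<in> fibre k \<epsilon> t"
    using da_rot_fibre[OF k f(1), of t] by simp
  have "da_rot (rate k \<epsilon>) t (da_gen (rate k \<epsilon>) f) \<in> da_orth (fibre k \<epsilon> t)"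
    unfolding da_orth_def
  proof (intro CollectI ballI)
    fix g assume g: "g \<in> fibre k \<epsilon> t"
    have "da_rot (rate k \<epsilon>) (- t) g \<in> fibre k \<epsilon> 0"
      using da_rot_fibre[OF k g, of "- t"] by simp
    then have "da_cinner (da_gen (rate k \<epsilon>) f) (da_rot (rate k \<epsilon>) (- t) g) = 0"
      by (rule da_cinner_gen_fibre[OF assms])
    then have "da_cinner (da_rot (rate k \<epsilon>) t (da_gen (rate k \<epsilon>) f))
        (da_rot (rate k \<epsilon>) t (da_rot (rate k \<epsilon>) (- t) g)) = 0"
      by (simp only: da_cinner_rot)
    then show "da_cinner (da_rot (rate k \<epsilon>) t (da_gen (rate k \<epsilon>) f)) g = 0"
      by (simp add: da_rot_rot)
  qed
  then show "connection k \<epsilon> (\<lambda>t. da_rot (rate k \<epsilon>) t f) t = 0"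
    unfolding connection_def vector_derivative_at[OF da_rot_has_vector_derivative[OF f(2)]]
    by (simp add: fibre_def da_proj_eq_0_iff)
qed

section \<open>Truncated frame expansions\<close>

lemma da_coeff_sum: "da_coeff (sum f A) p = (\<Sum>i\<in>A. da_coeff (f i) p)"
  by (induction A rule: infinite_finite_induct) (auto simp: da_coeff_add da_coeff_0)

text \<open>The partial frame expansion of \<open>f\<close> over rows up to \<open>N\<close>; the
  weight compensates the coefficient of \<open>alpha\<close> at \<open>(r, n)\<close>, which is the
  inverse weight.\<close>

definition fibre_trunc :: "nat \<Rightarrow> real \<Rightarrow> real \<Rightarrow> nat \<Rightarrow> drury_arveson \<Rightarrow> drury_arveson" where
  "fibre_trunc k \<epsilon> t N f = (\<Sum>(r, n)\<in>{..<k} \<times> {..N}. (of_real (da_weight r n) * da_coeff f (r, n)) *\<^sub>C alpha k \<epsilon> r n t)"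

lemma da_coeff_fibre_trunc:
  assumes k: "k \<ge> 1" and e: "0 < \<epsilon>" "\<epsilon> < 1" and f: "f \<in> fibre k \<epsilon> t"
  shows "da_coeff (fibre_trunc k \<epsilon> t N f) p = (if snd p \<le> N then da_coeff f p else 0)"
proof -
  define r q n where "r = fst p mod k" and "q = fst p div k" and "n = snd p"
  have p: "p = (r + k * q, n)" by (simp add: r_def q_def n_def)
  have r: "r < k" using k by (simp add: r_def)
  define c where "c x = of_real (da_weight (fst x) (snd x)) * da_coeff f x" for x
  have "da_coeff (fibre_trunc k \<epsilon> t N f) p = (\<Sum>x\<in>{..<k} \<times> {..N}. c x * frame_coeff k \<epsilon> (fst x) (snd x) t p)"
    unfolding fibre_trunc_def da_coeff_sum
    by (intro sum.cong refl) (auto simp: da_coeff_scale da_coeff_alpha[OF k e] c_def)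
  also have "\<dots> = (\<Sum>x\<in>{..<k} \<times> {..N}. if x = (r, n) then c (r, n) * frame_coeff k \<epsilon> r n t p else 0)"
    by (intro sum.cong refl) (auto simp: frame_coeff_def r_def n_def)
  also have "\<dots> = (if n \<le> N then c (r, n) * frame_coeff k \<epsilon> r n t p else 0)"
    using r by (subst sum.delta) auto
  also have "c (r, n) * frame_coeff k \<epsilon> r n t p = da_coeff f p"
  proof -
    define w where "w = da_weight (r + k * q) n"
    have w: "w > 0" by (simp add: w_def)
    have "c (r, n) * frame_coeff k \<epsilon> r n t p = inverse (of_real w) * (of_real (\<epsilon> ^ q) * cis (- (real q * t)) * c (r, n))"
      using r by (simp add: frame_coeff_def p w_def)
    also have "of_real (\<epsilon> ^ q) * cis (- (real q * t)) * c (r, n) = of_real w * da_coeff f (r + k * q, n)"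
      using fibre_coeff[OF f, of r q n] by (simp add: w_def c_def)
    finally show ?thesis using w by (simp add: p)
  qed
  finally show ?thesis by (simp add: n_def)
qed

lemma da_truncations_tendsto:
  assumes X: "\<And>N p. da_coeff (X N) p = (if snd p \<le> N then da_coeff f p else 0)"
  shows "X \<longlonglongrightarrow> f"
proof (rule metric_LIMSEQ_I)
  fix e :: real assume e: "e > 0"
  define h where "h p = da_weight (fst p) (snd p) * (cmod (da_coeff f p))\<^sup>2" for p
  have h0: "h p \<ge> 0" for p by (simp add: h_def)
  have hs: "h summable_on UNIV"
    using da_l2_coeff[of f] by (simp add: da_l2_def h_def[abs_def])
  then have hf: "(h has_sum (norm f)\<^sup>2) UNIV"
    unfolding da_norm_sq' h_def[symmetric] by (rule has_sum_infsum)
  then have "\<forall>\<^sub>F A in finite_subsets_at_top UNIV. dist (sum h A) ((norm f)\<^sup>2) < e\<^sup>2"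
    using e by (auto simp: has_sum_def tendsto_iff)
  then obtain A where A: "finite A" "dist (sum h A) ((norm f)\<^sup>2) < e\<^sup>2"
    by (auto simp: eventually_finite_subsets_at_top)
  obtain N where N: "\<And>p. p \<in> A \<Longrightarrow> snd p \<le> N"
    using A(1) by (meson Max_ge finite_imageI imageI)
  have "dist (X M) f < e" if "M \<ge> N" for M
  proof (rule power2_less_imp_less)
    \<comment> \<open>For \<open>M >= N\<close> the truncation agrees with \<open>f\<close> on
      \<open>A\<close>, so the error is at most the mass of \<open>f\<close> outside
      \<open>A\<close>.\<close>
    have tail: "((\<lambda>p. if p \<in> A then 0 else h p) has_sum ((norm f)\<^sup>2 - sum h A)) UNIV"
    proof -
      have "(h has_sum ((norm f)\<^sup>2 - sum h A)) (UNIV - A)"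
        using A(1) by (intro has_sum_Diff hf has_sum_finite) auto
      then show ?thesis
        by (rule has_sum_cong_neutral[THEN iffD1, rotated -1]) auto
    qed
    have "((\<lambda>p. da_weight (fst p) (snd p) * (cmod (da_coeff (X M - f) p))\<^sup>2) has_sum (norm (X M - f))\<^sup>2) UNIV"
      unfolding da_norm_sq' using da_l2_coeff[of "X M - f"] by (intro has_sum_infsum) (simp add: da_l2_def)
    then have "(norm (X M - f))\<^sup>2 \<le> (norm f)\<^sup>2 - sum h A"
    proof (rule has_sum_mono[OF _ tail])
      fix p
      show "da_weight (fst p) (snd p) * (cmod (da_coeff (X M - f) p))\<^sup>2 \<le> (if p \<in> A then 0 else h p)"
        using N[of p] that by (auto simp: da_coeff_diff X h_def)
    qed
    also have "\<dots> < e\<^sup>2" using A(2) by (simp add: dist_real_def)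
    finally show "(dist (X M) f)\<^sup>2 < e\<^sup>2" by (simp add: dist_norm)
  qed (use e in simp)
  then show "\<exists>N. \<forall>M\<ge>N. dist (X M) f < e" by blast
qed

lemma fibre_trunc_tendsto:
  assumes "k \<ge> 1" "0 < \<epsilon>" "\<epsilon> < 1" "f \<in> fibre k \<epsilon> t"
  shows "(\<lambda>N. fibre_trunc k \<epsilon> t N f) \<longlonglongrightarrow> f"
  by (rule da_truncations_tendsto) (rule da_coeff_fibre_trunc[OF assms])

lemma da_orth_sum: "(\<And>i. i \<in> I \<Longrightarrow> f i \<in> da_orth A) \<Longrightarrow> sum f I \<in> da_orth A"
  by (induction I rule: infinite_finite_induct) (auto intro: da_orth_add da_orth_0)

lemma fibre_trunc_in_fibre:
  assumes "k \<ge> 1" "0 < \<epsilon>" "\<epsilon> < 1"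
  shows "fibre_trunc k \<epsilon> t N f \<in> fibre k \<epsilon> t"
  unfolding fibre_trunc_def using fibre_scale[OF alpha_in_fibre[OF assms]]
  unfolding fibre_def by (intro da_orth_sum) auto

text \<open>Being finite combinations of rapid vectors, truncations have smooth orbits even when
  \<open>f\<close> itself is not rapid.\<close>

lemma da_rapid_fibre_trunc:
  assumes "k \<ge> 1" "0 < \<epsilon>" "\<epsilon> < 1"
  shows "da_rapid (rate k \<epsilon>) (fibre_trunc k \<epsilon> t N f)"
  unfolding fibre_trunc_def using da_rapid_scale[OF da_rapid_alpha[OF assms]]
  by (intro da_rapid_sum) auto

section \<open>Flat sections are orbits, and the solution operator\<close>

lemma flat_section_deriv:
  assumes "flat_section k \<epsilon> X"
  shows "(X has_vector_derivative vector_derivative X (at t)) (at t)"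
    and "vector_derivative X (at t) \<in> da_orth (fibre k \<epsilon> t)" and "X t \<in> fibre k \<epsilon> t"
proof -
  have "smooth_curve X"
    using assms by (simp add: flat_section_def smooth_sections_def)
  then have "((\<lambda>\<eta> s. vector_derivative \<eta> (at s)) ^^ 0) X differentiable (at t)"
    unfolding smooth_curve_def by blast
  then show "(X has_vector_derivative vector_derivative X (at t)) (at t)"
    by (simp add: vector_derivative_works)
  show "vector_derivative X (at t) \<in> da_orth (fibre k \<epsilon> t)"
    using assms by (simp add: flat_section_def connection_def fibre_def da_proj_eq_0_iff)
  show "X t \<in> fibre k \<epsilon> t"
    using assms by (simp add: flat_section_def smooth_sections_def)
qed

text \<open>The difference stays in the fibre while its derivative is orthogonal to the fibre, so
  the derivative of the squared norm vanishes.\<close>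

lemma flat_section_diff_norm:
  assumes X: "flat_section k \<epsilon> X" and Y: "flat_section k \<epsilon> Y"
  shows "norm (X t - Y t) = norm (X 0 - Y 0)"
proof -
  define Z where "Z s = X s - Y s" for s
  define Z' where "Z' s = vector_derivative X (at s) - vector_derivative Y (at s)" for s
  have "((\<lambda>s. inner (Z s) (Z s)) has_real_derivative 0) (at s)" for s
  proof -
    have d: "(Z has_derivative (\<lambda>h. h *\<^sub>R Z' s)) (at s)"
      unfolding has_vector_derivative_def[symmetric] Z_def Z'_def
      by (intro has_vector_derivative_diff flat_section_deriv(1)[OF X] flat_section_deriv(1)[OF Y])
    have "Z s \<in> fibre k \<epsilon> s"
      using da_orth_diff flat_section_deriv(3)[OF X] flat_section_deriv(3)[OF Y]
      by (simp add: Z_def fibre_def)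
    moreover have "Z' s \<in> da_orth (fibre k \<epsilon> s)"
      unfolding Z'_def by (intro da_orth_diff flat_section_deriv(2)[OF X] flat_section_deriv(2)[OF Y])
    ultimately have "inner (Z' s) (Z s) = 0"
      by (simp add: da_orth_def inner_drury_arveson_def)
    then have "(\<lambda>h. inner (Z s) (h *\<^sub>R Z' s) + inner (h *\<^sub>R Z' s) (Z s)) = (*) 0"
      by (auto simp: inner_commute)
    with has_derivative_inner[OF d d] show ?thesis
      by (simp add: has_field_derivative_def)
  qed
  then have "inner (Z t) (Z t) = inner (Z 0) (Z 0)"
    by (intro DERIV_isconst_all) blast
  then show ?thesis by (simp add: norm_eq_sqrt_inner Z_def)
qed

text \<open>The orbits of the truncations of \<open>X 0\<close> are flat, so each keeps a constant
  distance from \<open>X\<close>. These distances tend to 0, while the same orbits converge to the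
  orbit of \<open>X 0\<close>.\<close>

lemma flat_section_eq_rot:
  assumes k: "k \<ge> 1" and e: "0 < \<epsilon>" "\<epsilon> < 1" and X: "flat_section k \<epsilon> X"
  shows "X t = da_rot (rate k \<epsilon>) t (X 0)"
proof (rule LIMSEQ_unique)
  define T where "T N = fibre_trunc k \<epsilon> 0 N (X 0)" for N
  have T: "T \<longlonglongrightarrow> X 0"
    unfolding T_def by (intro fibre_trunc_tendsto k e flat_section_deriv(3)[OF X])
  then show "(\<lambda>N. da_rot (rate k \<epsilon>) t (T N)) \<longlonglongrightarrow> da_rot (rate k \<epsilon>) t (X 0)"
    by (rule isCont_tendsto_compose[OF isCont_da_rot])
  have "dist (da_rot (rate k \<epsilon>) t (T N)) (X t) = dist (T N) (X 0)" for N
  proof -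
    have "flat_section k \<epsilon> (\<lambda>t. da_rot (rate k \<epsilon>) t (T N))"
      unfolding T_def by (intro flat_da_rot fibre_trunc_in_fibre da_rapid_fibre_trunc k e)
    from flat_section_diff_norm[OF this X, of t] show ?thesis by (simp add: dist_norm)
  qed
  with T show "(\<lambda>N. da_rot (rate k \<epsilon>) t (T N)) \<longlonglongrightarrow> X t"
    by (simp only: tendsto_dist_iff[of T] tendsto_dist_iff[of "\<lambda>N. da_rot (rate k \<epsilon>) t (T N)"])
qed

text \<open>Limits of flat sections are orbits because rotations are continuous and the fibre is
  closed. Conversely, the orbits of truncations converge uniformly in time because rotations are
  isometries.\<close>

lemma solution_iff:
  assumes k: "k \<ge> 1" and e: "0 < \<epsilon>" "\<epsilon> < 1"
  shows "solution k \<epsilon> \<xi> \<longleftrightarrow> \<xi> 0 \<in> fibre k \<epsilon> 0 \<and> \<xi> = (\<lambda>t. da_rot (rate k \<epsilon>) t (\<xi> 0))"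
proof
  assume "solution k \<epsilon> \<xi>"
  then obtain X where X: "\<And>i. flat_section k \<epsilon> (X i)" and lim: "uniform_limit UNIV X \<xi> sequentially"
    by (auto simp: solution_def)
  have lim: "(\<lambda>i. X i t) \<longlonglongrightarrow> \<xi> t" for t
    by (rule tendsto_uniform_limitI[OF lim]) simp
  have "\<xi> 0 \<in> fibre k \<epsilon> 0"
    by (rule closed_sequentially[OF closed_fibre _ lim]) (rule flat_section_deriv(3)[OF X])
  moreover have "\<xi> t = da_rot (rate k \<epsilon>) t (\<xi> 0)" for t
  proof (rule LIMSEQ_unique[OF lim])
    have "(\<lambda>i. da_rot (rate k \<epsilon>) t (X i 0)) \<longlonglongrightarrow> da_rot (rate k \<epsilon>) t (\<xi> 0)"
      by (rule isCont_tendsto_compose[OF isCont_da_rot lim])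
    then show "(\<lambda>i. X i t) \<longlonglongrightarrow> da_rot (rate k \<epsilon>) t (\<xi> 0)"
      unfolding flat_section_eq_rot[OF k e X, of _ t, symmetric] .
  qed
  ultimately show "\<xi> 0 \<in> fibre k \<epsilon> 0 \<and> \<xi> = (\<lambda>t. da_rot (rate k \<epsilon>) t (\<xi> 0))" by blast
next
  assume \<xi>: "\<xi> 0 \<in> fibre k \<epsilon> 0 \<and> \<xi> = (\<lambda>t. da_rot (rate k \<epsilon>) t (\<xi> 0))"
  define T where "T N = fibre_trunc k \<epsilon> 0 N (\<xi> 0)" for N
  have "T \<longlonglongrightarrow> \<xi> 0"
    unfolding T_def using \<xi> by (intro fibre_trunc_tendsto k e) blast
  moreover have "dist (da_rot (rate k \<epsilon>) t (T N)) (\<xi> t) = dist (T N) (\<xi> 0)" for t N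
    by (subst conjunct2[OF \<xi>]) (simp add: dist_norm flip: da_rot_diff)
  ultimately have "uniform_limit UNIV (\<lambda>N t. da_rot (rate k \<epsilon>) t (T N)) \<xi> sequentially"
    by (simp add: uniform_limit_iff tendsto_iff)
  moreover have "flat_section k \<epsilon> (\<lambda>t. da_rot (rate k \<epsilon>) t (T N))" for N
    unfolding T_def by (intro flat_da_rot k e fibre_trunc_in_fibre da_rapid_fibre_trunc)
  ultimately show "solution k \<epsilon> \<xi>"
    unfolding solution_def by (intro exI[of _ "\<lambda>N t. da_rot (rate k \<epsilon>) t (T N)"] conjI allI)
qed

lemma solution_operator_eq_rot:
  assumes "k \<ge> 1" "0 < \<epsilon>" "\<epsilon> < 1" "f \<in> fibre k \<epsilon> 0"
  shows "solution_operator k \<epsilon> t f = da_rot (rate k \<epsilon>) t f"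
proof -
  have "(THE \<xi>. solution k \<epsilon> \<xi> \<and> \<xi> 0 = f) = (\<lambda>t. da_rot (rate k \<epsilon>) t f)"
    by (rule the_equality) (use assms in \<open>auto simp: solution_iff\<close>)
  then show ?thesis by (simp add: solution_operator_def)
qed

lemma da_unitary_solution_operator:
  assumes k: "k \<ge> 1" and e: "0 < \<epsilon>" "\<epsilon> < 1"
  shows "da_unitary (fibre k \<epsilon> 0) (fibre k \<epsilon> t) (solution_operator k \<epsilon> t)"
proof -
  let ?V = "da_rot (rate k \<epsilon>)"
  note eq = solution_operator_eq_rot[OF k e]
  have "bij_betw (?V t) (fibre k \<epsilon> 0) (fibre k \<epsilon> t)"
  \<comment> \<open>The inverse is the rotation by \<open>- t\<close>, which returns the fibre over
    \<open>t\<close> to the fibre over 0.\<close>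
  proof (rule bij_betw_byWitness[where f' = "?V (- t)"])
    show "?V t ` fibre k \<epsilon> 0 \<subseteq> fibre k \<epsilon> t"
      using da_rot_fibre[OF k, of _ \<epsilon> 0 t] by auto
    show "?V (- t) ` fibre k \<epsilon> t \<subseteq> fibre k \<epsilon> 0"
      using da_rot_fibre[OF k, of _ \<epsilon> t "- t"] by auto
  qed (simp_all add: da_rot_rot)
  then have "bij_betw (solution_operator k \<epsilon> t) (fibre k \<epsilon> 0) (fibre k \<epsilon> t)"
    by (rule bij_betw_cong[THEN iffD1, rotated]) (simp add: eq)
  moreover have "f + g \<in> fibre k \<epsilon> 0" if "f \<in> fibre k \<epsilon> 0" "g \<in> fibre k \<epsilon> 0" for f g
    using that unfolding fibre_def by (rule da_orth_add)
  ultimately show ?thesis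
    unfolding da_unitary_def by (simp add: eq fibre_scale da_rot_add da_rot_scale da_cinner_rot)
qed

text \<open>Orthonormality is carried from the \<open>beta\<close> at time 0 by the unitary group.
  Density holds because each truncation is a finite combination of the \<open>gamma\<close>, which
  are nonzero multiples of the \<open>alpha\<close>.\<close>

lemma da_orthonormal_basis_gamma:
  assumes k: "k \<ge> 1" and e: "0 < \<epsilon>" "\<epsilon> < 1"
  shows "da_orthonormal_basis (J k) (\<lambda>(r, n). gamma k \<epsilon> r n t) (fibre k \<epsilon> t)"
proof -
  define G where "G = (\<lambda>(r, n). gamma k \<epsilon> r n t) ` J k"
  have J: "(r, n) \<in> J k \<longleftrightarrow> r < k" for r n
    using k by (auto simp: J_def)
  have fib: "fibre k \<epsilon> t = da_orth (da_of_poly ` ideal_t k \<epsilon> t)"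
    by (simp add: fibre_def)
  have "gamma k \<epsilon> r n t \<in> fibre k \<epsilon> t" if "r < k" for r n
    unfolding gamma_def by (intro fibre_scale beta_in_fibre k e that)
  then have "DA.span G \<subseteq> fibre k \<epsilon> t"
    unfolding fib by (intro DA.span_minimal DA_subspace_da_orth) (auto simp: G_def J)
  then have "closure (DA.span G) \<subseteq> fibre k \<epsilon> t"
    unfolding fib by (rule closure_minimal[OF _ closed_da_orth])
  moreover have "fibre k \<epsilon> t \<subseteq> closure (DA.span G)"
  proof
    fix f assume f: "f \<in> fibre k \<epsilon> t"
    have alpha: "alpha k \<epsilon> r n t \<in> DA.span G" if r: "r < k" for r n
    proof -
      define c where "c = cis (freq k \<epsilon> r n * t) * complex_of_real (inverse (norm (alpha k \<epsilon> r n t)))"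
      have c: "c \<noteq> 0" using alpha_nonzero[OF k e r, of n t] by (simp add: c_def)
      have "gamma k \<epsilon> r n t = c *\<^sub>C alpha k \<epsilon> r n t"
        by (simp add: gamma_def beta_def scaleR_drury_arveson_def c_def)
      then have "alpha k \<epsilon> r n t = inverse c *\<^sub>C gamma k \<epsilon> r n t"
        using c by simp
      moreover have "gamma k \<epsilon> r n t \<in> G" using r by (force simp: G_def J)
      ultimately show ?thesis by (metis DA.span_base DA.span_scale)
    qed
    have "fibre_trunc k \<epsilon> t N f \<in> DA.span G" for N
      unfolding fibre_trunc_def by (intro DA.span_sum) (auto intro: DA.span_scale alpha)
    with fibre_trunc_tendsto[OF k e f] show "f \<in> closure (DA.span G)"
      unfolding closure_sequential by (intro exI[of _ "\<lambda>N. fibre_trunc k \<epsilon> t N f"] conjI allI)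
  qed
  moreover have "da_cinner (gamma k \<epsilon> r n t) (gamma k \<epsilon> r' n' t) = (if (r, n) = (r', n') then 1 else 0)"
    if "r < k" "r' < k" for r n r' n'
    using that by (simp only: gamma_eq_rot[OF k e] da_cinner_rot da_cinner_beta[OF k e])
  ultimately show ?thesis
    unfolding da_orthonormal_basis_def G_def[symmetric] by (auto simp: J split: if_splits)
qed

theorem theorem2p4:
  fixes k :: nat and \<epsilon> :: real
  assumes "k \<ge> 1" and "0 < \<epsilon>" and "\<epsilon> < 1"
  shows
    "(\<forall>\<xi>\<^sub>0\<in>fibre k \<epsilon> 0. \<exists>!\<xi>. solution k \<epsilon> \<xi> \<and> \<xi> 0 = \<xi>\<^sub>0) \<and>
     (\<forall>\<xi>. flat_section k \<epsilon> \<xi> \<longrightarrow> (\<forall>t. solution_operator k \<epsilon> t (\<xi> 0) = \<xi> t)) \<and>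

     (\<forall>(r, n)\<in>J k. \<forall>t. solution_operator k \<epsilon> t (beta k \<epsilon> r n 0)
        = cis (freq k \<epsilon> r n * t) *\<^sub>C beta k \<epsilon> r n t) \<and>
     (\<forall>(r, n)\<in>J k. complex_of_real (freq k \<epsilon> r n) =
        (- of_nat r * (\<Sum>j<k. zeta k j powi (- int r) * acoef k \<epsilon> j powi (- int n - 1))
         + of_real (F k \<epsilon>) * (of_nat n + 1)
           * (\<Sum>j<k. zeta k j powi (- int r + 1) * acoef k \<epsilon> j powi (- int n - 2)))
        / (of_nat k * (\<Sum>j<k. zeta k j powi (- int r) * acoef k \<epsilon> j powi (- int n - 1)))) \<and>

     (\<forall>t. da_unitary (fibre k \<epsilon> 0) (fibre k \<epsilon> t) (solution_operator k \<epsilon> t)) \<and>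

     (\<forall>r\<le>k - 1. (\<lambda>n. freq k \<epsilon> r n
        - (F k \<epsilon> / (real k * (1 - F k \<epsilon>)) * real n
           + F k \<epsilon> / (real k * (1 - F k \<epsilon>)) - real r / real k)) \<longlonglongrightarrow> 0) \<and>

     (\<forall>(r, n)\<in>J k. flat_section k \<epsilon> (gamma k \<epsilon> r n)) \<and>
     (\<forall>t. da_orthonormal_basis (J k) (\<lambda>(r, n). gamma k \<epsilon> r n t) (fibre k \<epsilon> t))"
proof (intro conjI)
  note solution_operator = solution_operator_eq_rot[OF assms]
  have le: "r < k" if "r \<le> k - 1" for r
    using that assms(1) by simp
  show "\<forall>\<xi>\<^sub>0\<in>fibre k \<epsilon> 0. \<exists>!\<xi>. solution k \<epsilon> \<xi> \<and> \<xi> 0 = \<xi>\<^sub>0"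
  proof
    fix \<xi>\<^sub>0 assume "\<xi>\<^sub>0 \<in> fibre k \<epsilon> 0"
    then show "\<exists>!\<xi>. solution k \<epsilon> \<xi> \<and> \<xi> 0 = \<xi>\<^sub>0"
      by (intro ex1I[of _ "\<lambda>t. da_rot (rate k \<epsilon>) t \<xi>\<^sub>0"]) (auto simp: solution_iff[OF assms])
  qed
  show "\<forall>\<xi>. flat_section k \<epsilon> \<xi> \<longrightarrow> (\<forall>t. solution_operator k \<epsilon> t (\<xi> 0) = \<xi> t)"
    using solution_operator flat_section_deriv(3) flat_section_eq_rot[OF assms] by metis
  show "\<forall>(r, n)\<in>J k. \<forall>t. solution_operator k \<epsilon> t (beta k \<epsilon> r n 0)
      = cis (freq k \<epsilon> r n * t) *\<^sub>C beta k \<epsilon> r n t"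
    using solution_operator[OF beta_in_fibre[OF assms le]] gamma_eq_rot[OF assms le]
    by (auto simp: J_def gamma_def)
  show "\<forall>(r, n)\<in>J k. flat_section k \<epsilon> (gamma k \<epsilon> r n)"
  proof (clarify, unfold J_def mem_Collect_eq prod.case)
    fix r n assume "r \<le> k - 1"
    note r = le[OF this]
    have "gamma k \<epsilon> r n = (\<lambda>t. da_rot (rate k \<epsilon>) t (beta k \<epsilon> r n 0))"
      using gamma_eq_rot[OF assms r] by blast
    then show "flat_section k \<epsilon> (gamma k \<epsilon> r n)"
      by (simp only:) (intro flat_da_rot beta_in_fibre da_rapid_beta assms r)
  qed
qed (use freq_closed_form(1)[OF assms] freq_asymptotics[OF assms] da_unitary_solution_operator[OF assms]
    da_orthonormal_basis_gamma[OF assms] assms(1) in \<open>auto simp: J_def\<close>)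

end
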